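(* Let $B\in\mathbb{DQ}^{m\times n}$ be a dual quaternion matrix with $B_{st}\ne O$, and let $A=B^*B$. Then there exists a unitary matrix $U\in\mathbb{DQ}^{n\times n}$ such that $$U^*AU={\rm diag}(\lambda_1+\lambda_{1,1}\epsilon,\cdots,\lambda_1+\lambda_{1,k_1}\epsilon,\lambda_2+\lambda_{2,1}\epsilon,\cdots,\lambda_s+\lambda_{s,k_s}\epsilon,O),$$ where $\lambda_1>\cdots>\lambda_s>0$ and $\lambda_{1,1}\ge\cdots\ge\lambda_{1,k_1}$, $\cdots$, $\lambda_{s,1}\ge\cdots\ge\lambda_{s,k_s}$ are real numbers. Counting possible multiplicities of the $\lambda_{i,j}$, the real numbers $\lambda_i$ and $\lambda_{i,j}$ for $i=1,\cdots,s$ and $j=1,\cdots,k_i$ are uniquely determined.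
   Context: $\mathbb{Q}$ denotes the real quaternions and $q^*$ the quaternion conjugate. $\epsilon$ is the infinitesimal unit: $\epsilon\neq 0$, $\epsilon^2=0$, and $\epsilon$ commutes with all quaternions. A dual quaternion is $q=q_{st}+q_{\mathcal I}\epsilon$ with $q_{st},q_{\mathcal I}\in\mathbb{Q}$ (set $\mathbb{DQ}$), with conjugate $q^*=q_{st}^*+q_{\mathcal I}^*\epsilon$. A matrix over $\mathbb{DQ}$ is written $B=B_{st}+B_{\mathcal I}\epsilon$ with quaternion matrices $B_{st},B_{\mathcal I}$; $^*$ denotes conjugate transpose. A square matrix $U$ is unitary if $U^*U=I$. The final block $O$ is a square zero block, possibly empty. *)

theory Defs
  imports Complex_Main "Jordan_Normal_Form.Matrix"
begin

section \<open>Quaternions\<close>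

datatype quat = Quat (qre: real) (qi: real) (qj: real) (qk: real)

lemma quat_eq_iff: "x = y \<longleftrightarrow> qre x = qre y \<and> qi x = qi y \<and> qj x = qj y \<and> qk x = qk y"
  by (cases x; cases y) simp

instantiation quat :: real_div_algebra
begin

definition "0 = Quat 0 0 0 0"
definition "1 = Quat 1 0 0 0"
definition "x + y = Quat (qre x + qre y) (qi x + qi y) (qj x + qj y) (qk x + qk y)"
definition "x - y = Quat (qre x - qre y) (qi x - qi y) (qj x - qj y) (qk x - qk y)"
definition "- x = Quat (- qre x) (- qi x) (- qj x) (- qk x)"
definition "scaleR r x = Quat (r * qre x) (r * qi x) (r * qj x) (r * qk x)"
definition "x * y = Quat
  (qre x * qre y - qi x * qi y - qj x * qj y - qk x * qk y)
  (qre x * qi y + qi x * qre y + qj x * qk y - qk x * qj y)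
  (qre x * qj y - qi x * qk y + qj x * qre y + qk x * qi y)
  (qre x * qk y + qi x * qj y - qj x * qi y + qk x * qre y)"
definition "inverse x =
  (let d = (qre x)\<^sup>2 + (qi x)\<^sup>2 + (qj x)\<^sup>2 + (qk x)\<^sup>2
   in Quat (qre x / d) (- qi x / d) (- qj x / d) (- qk x / d))"
definition "x div y = x * inverse y" for x y :: quat

lemmas quat_arith_defs = zero_quat_def one_quat_def plus_quat_def minus_quat_def
  uminus_quat_def scaleR_quat_def times_quat_def

instance
proof
  fix x :: quat
  define d where "d = (qre x)\<^sup>2 + (qi x)\<^sup>2 + (qj x)\<^sup>2 + (qk x)\<^sup>2"
  assume "x \<noteq> 0"
  then have "d \<noteq> 0"
    by (auto simp: d_def quat_eq_iff zero_quat_def add_nonneg_eq_0_iff)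
  moreover have "inverse x = Quat (qre x / d) (- qi x / d) (- qj x / d) (- qk x / d)"
    by (simp add: inverse_quat_def Let_def d_def)
  moreover have "qre x * qre x + qi x * qi x + qj x * qj x + qk x * qk x = d"
    by (simp add: d_def power2_eq_square)
  ultimately show "inverse x * x = 1" and "x * inverse x = 1"
    by (simp_all add: quat_eq_iff times_quat_def
        one_quat_def diff_divide_distrib[symmetric] add_divide_distrib[symmetric] algebra_simps)
qed (auto simp: quat_eq_iff quat_arith_defs inverse_quat_def divide_quat_def algebra_simps)

end

definition quat_cnj :: "quat \<Rightarrow> quat" where
  "quat_cnj q = Quat (qre q) (- qi q) (- qj q) (- qk q)"


section \<open>Dual quaternions\<close>

text \<open>\<open>DQ a b\<close> stands for \<open>a + b \<epsilon>\<close>; the product is the one forced by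
  \<open>\<epsilon> * \<epsilon> = 0\<close> and by \<open>\<epsilon>\<close> commuting with all quaternions.\<close>

datatype dual_quat = DQ (st: quat) (inft: quat)

lemma dual_quat_eq_iff: "x = y \<longleftrightarrow> st x = st y \<and> inft x = inft y"
  by (cases x; cases y) simp

instantiation dual_quat :: real_algebra_1
begin

definition "0 = DQ 0 0"
definition "1 = DQ 1 0"
definition "x + y = DQ (st x + st y) (inft x + inft y)"
definition "x - y = DQ (st x - st y) (inft x - inft y)"
definition "- x = DQ (- st x) (- inft x)"
definition "scaleR r x = DQ (r *\<^sub>R st x) (r *\<^sub>R inft x)"
definition "x * y = DQ (st x * st y) (st x * inft y + inft x * st y)"

lemmas dual_quat_arith_defs = zero_dual_quat_def one_dual_quat_def plus_dual_quat_def
  minus_dual_quat_def uminus_dual_quat_def scaleR_dual_quat_def times_dual_quat_def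

instance
  by standard (auto simp: dual_quat_eq_iff dual_quat_arith_defs algebra_simps)

end

definition eps :: dual_quat ("\<epsilon>") where
  "\<epsilon> = DQ 0 1"

lemma eps_nonzero: "\<epsilon> \<noteq> 0"
  and eps_square: "\<epsilon> * \<epsilon> = 0"
  and eps_commute: "DQ q 0 * \<epsilon> = \<epsilon> * DQ q 0"
  and DQ_decompose: "DQ p q = DQ p 0 + DQ q 0 * \<epsilon>"
  by (simp_all add: eps_def dual_quat_eq_iff dual_quat_arith_defs)

definition dq_cnj :: "dual_quat \<Rightarrow> dual_quat" where
  "dq_cnj q = DQ (quat_cnj (st q)) (quat_cnj (inft q))"


section \<open>Dual quaternion matrices\<close>

text \<open>The library's \<open>mat_adjoint\<close> is restricted to (commutative) fields.\<close>

definition dq_adjoint :: "dual_quat mat \<Rightarrow> dual_quat mat" where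
  "dq_adjoint M = mat (dim_col M) (dim_row M) (\<lambda>(i, j). dq_cnj (M $$ (j, i)))"

definition st_mat :: "dual_quat mat \<Rightarrow> quat mat" where
  "st_mat M = map_mat st M"

definition dq_unitary :: "nat \<Rightarrow> dual_quat mat \<Rightarrow> bool" where
  "dq_unitary n U \<longleftrightarrow> U \<in> carrier_mat n n \<and> dq_adjoint U * U = 1\<^sub>m n"

definition diag_of_list :: "'a :: zero list \<Rightarrow> 'a mat" where
  "diag_of_list ds = mat (length ds) (length ds) (\<lambda>(i, j). if i = j then ds ! i else 0)"

text \<open>The numbers \<open>\<lambda>\<^sub>i\<close> and \<open>\<lambda>\<^sub>i\<^sub>,\<^sub>j\<close> are recorded together with \<open>s\<close> and the \<open>k\<^sub>i\<close> as the list
  \<open>[(\<lambda>\<^sub>1, [\<lambda>\<^sub>1\<^sub>,\<^sub>1, \<dots>, \<lambda>\<^sub>1\<^sub>,\<^sub>k]), \<dots>, (\<lambda>\<^sub>s, [\<lambda>\<^sub>s\<^sub>,\<^sub>1, \<dots>, \<lambda>\<^sub>s\<^sub>,\<^sub>k])]\<close>. Both \<open>s\<close> and every \<open>k\<^sub>i\<close> are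
  positive, so no \<open>\<lambda>\<^sub>i\<close> is listed that does not occur on the diagonal.\<close>

type_synonym eig_data = "(real \<times> real list) list"

definition eig_data_ordered :: "eig_data \<Rightarrow> bool" where
  "eig_data_ordered L \<longleftrightarrow>
     L \<noteq> [] \<and> sorted_wrt (>) (map fst L) \<and>
     (\<forall>(l, ms) \<in> set L. l > 0 \<and> ms \<noteq> [] \<and> sorted_wrt (\<ge>) ms)"

definition eig_diagonal :: "eig_data \<Rightarrow> dual_quat list" where
  "eig_diagonal L = concat (map (\<lambda>(l, ms). map (\<lambda>m. of_real l + of_real m * \<epsilon>) ms) L)"

definition diagonalizes :: "nat \<Rightarrow> dual_quat mat \<Rightarrow> dual_quat mat \<Rightarrow> eig_data \<Rightarrow> bool" where
  "diagonalizes n A U L \<longleftrightarrow>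
     dq_unitary n U \<and> eig_data_ordered L \<and>
     (\<exists>r. dq_adjoint U * A * U = diag_block_mat [diag_of_list (eig_diagonal L), 0\<^sub>m r r])"

end

theory Submission
  imports Defs "Jordan_Normal_Form.Spectral_Radius" "HOL-Combinatorics.Permutations"
begin

text \<open>
  Existence. Every Hermitian dual quaternion matrix \<open>A\<^sub>0 + A\<^sub>1 \<epsilon>\<close> is unitarily similar to a diagonal
  matrix of dual reals: diagonalize \<open>A\<^sub>0\<close> over the quaternions, remove the entries of the infinitesimal
  part that connect different eigenvalues by a conjugation with \<open>1 + T \<epsilon>\<close>, and simultaneously
  diagonalize the two parts, which now commute. Over the quaternions, an eigenvector of a Hermitian
  matrix comes from one of the associated complex matrix of twice the size, and a Householder
  reflection splits it off. If \<open>A = B\<^sup>* B\<close> then a diagonal entry of \<open>(B U)\<^sup>* (B U)\<close> with zero standard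
  part belongs to a zero standard column of \<open>B U\<close>, so its infinitesimal part vanishes as well.

  Uniqueness. A unitary \<open>W = P + T \<epsilon>\<close> that intertwines two such diagonal matrices has
  \<open>P\<^sub>i\<^sub>j = 0\<close> unless the \<open>i\<close>-th and \<open>j\<close>-th dual reals agree, and the numbers \<open>\<bar>P\<^sub>i\<^sub>j\<bar>\<^sup>2\<close> form a
  doubly stochastic matrix, so both diagonals contain every dual real equally often.
\<close>

section \<open>Adjoints over a ring with involution\<close>

lemma mult_mat_entry:
  assumes "A \<in> carrier_mat n m" "B \<in> carrier_mat m k" "i < n" "j < k"
  shows "(A * B) $$ (i, j) = (\<Sum>l<m. A $$ (i, l) * B $$ (l, j))"
  using assms by (auto simp: scalar_prod_def atLeast0LessThan intro!: sum.cong)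

text \<open>The involution is a parameter, so that one development of adjoints and unitaries serves
  both quaternions and dual quaternions.\<close>

definition adjoint_by :: "('a \<Rightarrow> 'a) \<Rightarrow> 'a mat \<Rightarrow> 'a mat" where
  "adjoint_by c M = mat (dim_col M) (dim_row M) (\<lambda>(i, j). c (M $$ (j, i)))"

text \<open>As in \<open>dq_unitary\<close>, only a left inverse is demanded; that the adjoint is
  also a right inverse is a separate fact, proved for each of the two scalar rings.\<close>

definition unitary_by :: "('a::ring_1 \<Rightarrow> 'a) \<Rightarrow> nat \<Rightarrow> 'a mat \<Rightarrow> bool" where
  "unitary_by c n U \<longleftrightarrow> U \<in> carrier_mat n n \<and> adjoint_by c U * U = 1\<^sub>m n"

lemma unitary_by_carrier: "unitary_by c n U \<Longrightarrow> U \<in> carrier_mat n n"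
  by (simp add: unitary_by_def)

lemma adjoint_by_dims [simp]:
  "dim_row (adjoint_by c M) = dim_col M" "dim_col (adjoint_by c M) = dim_row M"
  by (simp_all add: adjoint_by_def)

lemma adjoint_by_carrier [simp]: "M \<in> carrier_mat n m \<Longrightarrow> adjoint_by c M \<in> carrier_mat m n"
  by (intro carrier_matI) (simp_all add: carrier_matD)

lemma adjoint_by_entry [simp]:
  "i < dim_col M \<Longrightarrow> j < dim_row M \<Longrightarrow> adjoint_by c M $$ (i, j) = c (M $$ (j, i))"
  by (simp add: adjoint_by_def)

text \<open>\<open>cj\<close> reverses products; this is what the adjoint of a matrix product needs
  when the scalars do not commute.\<close>

locale involution_ring =
  fixes cj :: "'a::ring_1 \<Rightarrow> 'a"
  assumes cj_add: "cj (x + y) = cj x + cj y"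
    and cj_mult: "cj (x * y) = cj y * cj x"
    and cj_cj [simp]: "cj (cj x) = x"
begin

abbreviation "adj \<equiv> adjoint_by cj"

lemma cj_0 [simp]: "cj 0 = 0"
  using cj_add[of 0 0] by simp

lemma cj_1 [simp]: "cj 1 = 1"
  using cj_mult[of "cj 1" 1] by simp

lemma cj_uminus: "cj (- x) = - cj x"
  using cj_add[of x "- x"] by (simp add: minus_unique)

lemma cj_diff: "cj (x - y) = cj x - cj y"
  using cj_add[of x "- y"] by (simp add: cj_uminus)

lemma cj_sum: "cj (sum f S) = (\<Sum>x\<in>S. cj (f x))"
  by (induction S rule: infinite_finite_induct) (auto simp: cj_add)

lemma adj_adj [simp]: "adj (adj M) = M"
  by (rule eq_matI) auto

lemma adj_one [simp]: "adj (1\<^sub>m n) = 1\<^sub>m n"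
  by (rule eq_matI) auto

lemma adj_zero [simp]: "adj (0\<^sub>m n m) = 0\<^sub>m m n"
  by (rule eq_matI) auto

lemma adj_mult:
  assumes A: "A \<in> carrier_mat n m" and B: "B \<in> carrier_mat m k"
  shows "adj (A * B) = adj B * adj A"
proof (rule eq_matI)
  fix i j assume "i < dim_row (adj B * adj A)" "j < dim_col (adj B * adj A)"
  then have ij: "i < k" "j < n" using A B by auto
  have "adj (A * B) $$ (i, j) = cj ((A * B) $$ (j, i))"
    using A B ij by (subst adjoint_by_entry) auto
  also have "\<dots> = (\<Sum>l<m. cj (B $$ (l, i)) * cj (A $$ (j, l)))"
    using mult_mat_entry[OF A B ij(2,1)] by (simp add: cj_sum cj_mult)
  also have "\<dots> = (adj B * adj A) $$ (i, j)"
    using A B ij by (subst mult_mat_entry[of _ k m _ n]) auto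
  finally show "adj (A * B) $$ (i, j) = (adj B * adj A) $$ (i, j)" .
qed (use A B in auto)

lemma adj_diff:
  "A \<in> carrier_mat n m \<Longrightarrow> B \<in> carrier_mat n m \<Longrightarrow> adj (A - B) = adj A - adj B"
  by (rule eq_matI) (auto simp: cj_diff)

lemma adj_four_block:
  assumes "A \<in> carrier_mat nr1 nc1" "B \<in> carrier_mat nr1 nc2"
    "C \<in> carrier_mat nr2 nc1" "D \<in> carrier_mat nr2 nc2"
  shows "adj (four_block_mat A B C D) = four_block_mat (adj A) (adj C) (adj B) (adj D)"
  using assms by (intro eq_matI) auto

lemma adj_congruence:
  assumes "A \<in> carrier_mat n n" "U \<in> carrier_mat n m"
  shows "adj (adj U * A * U) = adj U * adj A * U"
proof -
  have c: "adj U * A \<in> carrier_mat m n"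
    using assms by (meson adjoint_by_carrier mult_carrier_mat)
  have "adj (adj U * A * U) = adj U * adj (adj U * A)"
    by (rule adj_mult[OF c assms(2)])
  also have "adj (adj U * A) = adj A * U"
    using adj_mult[of "adj U" m n A n] assms by simp
  also have "adj U * (adj A * U) = adj U * adj A * U"
    using assms by (intro assoc_mult_mat[symmetric, of _ m n _ n _ m]) auto
  finally show ?thesis .
qed

lemma congruence_mult:
  assumes A: "A \<in> carrier_mat n n" and U: "U \<in> carrier_mat n k" and V: "V \<in> carrier_mat k l"
  shows "adj (U * V) * A * (U * V) = adj V * (adj U * A * U) * V"
proof -
  have c: "adj U * A \<in> carrier_mat k n" "adj V * (adj U * A) \<in> carrier_mat l n"
    using A U V by (meson adjoint_by_carrier mult_carrier_mat)+
  have "adj (U * V) * A * (U * V) = adj V * adj U * A * (U * V)"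
    by (simp add: adj_mult[OF U V])
  also have "adj V * adj U * A = adj V * (adj U * A)"
    using A U V by (intro assoc_mult_mat[of _ l k _ n _ n]) auto
  also have "adj V * (adj U * A) * (U * V) = adj V * (adj U * A) * U * V"
    using c U V by (intro assoc_mult_mat[symmetric, of _ l n _ k _ l]) auto
  also have "adj V * (adj U * A) * U = adj V * (adj U * A * U)"
    using c U V by (intro assoc_mult_mat[of _ l k _ n _ k]) auto
  finally show ?thesis .
qed

lemma unitary_mult:
  assumes "unitary_by cj n U" "unitary_by cj n V"
  shows "unitary_by cj n (U * V)"
proof -
  have c: "U \<in> carrier_mat n n" "V \<in> carrier_mat n n"
    using assms by (auto simp: unitary_by_def)
  \<comment> \<open>Unitarity says that congruence fixes the identity matrix, so it is inherited by
    composed congruences.\<close>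
  have "adj (U * V) * 1\<^sub>m n * (U * V) = adj V * (adj U * 1\<^sub>m n * U) * V"
    by (rule congruence_mult) (use c in auto)
  moreover have "M * 1\<^sub>m n = M" if "M \<in> carrier_mat n n" for M :: "'a mat"
    using that by (rule right_mult_one_mat)
  moreover have "U * V \<in> carrier_mat n n"
    using c by (rule mult_carrier_mat)
  ultimately show ?thesis
    using assms c by (simp add: unitary_by_def)
qed

text \<open>Column \<open>j\<close> of the permutation matrix \<open>P\<close> is the unit vector
  with index \<open>f j\<close>, so congruence by \<open>P\<close> merely relabels rows and
  columns.\<close>

lemma unitary_reindex:
  assumes f: "bij_betw f {..<n} {..<n}"
  obtains P where "unitary_by cj n P"
    "\<And>M. M \<in> carrier_mat n n \<Longrightarrow> adj P * M * P = mat n n (\<lambda>(i, j). M $$ (f i, f j))"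
proof
  define P :: "'a mat" where "P = mat n n (\<lambda>(i, j). if i = f j then 1 else 0)"
  have P: "P \<in> carrier_mat n n" by (simp add: P_def)
  have f_less: "f i < n" if "i < n" for i using f that by (auto dest: bij_betwE)
  have left: "(adj P * M) $$ (i, j) = M $$ (f i, j)"
    if "M \<in> carrier_mat n n" "i < n" "j < n" for M i j
  proof -
    have "(adj P * M) $$ (i, j) = (\<Sum>l<n. adj P $$ (i, l) * M $$ (l, j))"
      using that P by (intro mult_mat_entry) auto
    also have "\<dots> = (\<Sum>l<n. if l = f i then M $$ (l, j) else 0)"
      using that P f_less by (intro sum.cong) (auto simp: P_def)
    finally have "(adj P * M) $$ (i, j) = (\<Sum>l<n. if l = f i then M $$ (l, j) else 0)" .
    then show ?thesis using f_less that by simp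
  qed
  have right: "(M * P) $$ (i, j) = M $$ (i, f j)"
    if "M \<in> carrier_mat n n" "i < n" "j < n" for M i j
  proof -
    have "(M * P) $$ (i, j) = (\<Sum>l<n. M $$ (i, l) * P $$ (l, j))"
      using that P by (intro mult_mat_entry) auto
    also have "\<dots> = (\<Sum>l<n. if l = f j then M $$ (i, l) else 0)"
      using that P f_less by (intro sum.cong) (auto simp: P_def)
    finally have "(M * P) $$ (i, j) = (\<Sum>l<n. if l = f j then M $$ (i, l) else 0)" .
    then show ?thesis using f_less that by simp
  qed
  show "adj P * M * P = mat n n (\<lambda>(i, j). M $$ (f i, f j))" if M: "M \<in> carrier_mat n n" for M
  proof (rule eq_matI)
    have c: "adj P * M \<in> carrier_mat n n" using P M by (meson adjoint_by_carrier mult_carrier_mat)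
    fix i j
    assume "i < dim_row (mat n n (\<lambda>(i, j). M $$ (f i, f j)))"
      "j < dim_col (mat n n (\<lambda>(i, j). M $$ (f i, f j)))"
    then have ij: "i < n" "j < n" by auto
    show "(adj P * M * P) $$ (i, j) = mat n n (\<lambda>(i, j). M $$ (f i, f j)) $$ (i, j)"
      using right[OF c ij] left[OF M ij(1) f_less[OF ij(2)]] ij by simp
  qed (use P M in auto)
  have "inj_on f {..<n}" using f by (rule bij_betw_imp_inj_on)
  then have "adj P * P = 1\<^sub>m n"
    using left[OF P] P f_less
    by (intro eq_matI) (simp_all add: P_def inj_on_eq_iff)
  then show "unitary_by cj n P" using P by (simp add: unitary_by_def)
qed

end

section \<open>Diagonal matrices given by lists\<close>

lemma diag_of_list_carrier [simp]: "diag_of_list ds \<in> carrier_mat (length ds) (length ds)"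
  by (simp add: diag_of_list_def)

lemma diag_of_list_entry [simp]:
  "i < length ds \<Longrightarrow> j < length ds \<Longrightarrow> diag_of_list ds $$ (i, j) = (if i = j then ds ! i else 0)"
  by (simp add: diag_of_list_def)

lemma diag_of_list_Cons:
  "diag_of_list (d # ds) =
    four_block_mat (mat 1 1 (\<lambda>_. d)) (0\<^sub>m 1 (length ds)) (0\<^sub>m (length ds) 1) (diag_of_list ds)"
  by (rule eq_matI) (auto simp: diag_of_list_def nth_Cons split: nat.splits)

lemma diag_of_list_append_zeros:
  "diag_of_list (ds @ replicate r 0) = diag_block_mat [diag_of_list ds, 0\<^sub>m r r]"
  by (rule eq_matI) (auto simp: diag_of_list_def nth_append)

lemma diag_mult_entry:
  assumes "M \<in> carrier_mat n m" "length ds = n" "i < n" "j < m"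
  shows "(diag_of_list ds * M) $$ (i, j) = ds ! i * M $$ (i, j)"
proof -
  have "(diag_of_list ds * M) $$ (i, j) = (\<Sum>l<n. diag_of_list ds $$ (i, l) * M $$ (l, j))"
    using assms by (intro mult_mat_entry) auto
  also have "\<dots> = (\<Sum>l<n. if l = i then ds ! l * M $$ (l, j) else 0)"
    using assms by (intro sum.cong) auto
  finally show ?thesis using assms by simp
qed

lemma mult_diag_entry:
  assumes "M \<in> carrier_mat n m" "length ds = m" "i < n" "j < m"
  shows "(M * diag_of_list ds) $$ (i, j) = M $$ (i, j) * ds ! j"
proof -
  have "(M * diag_of_list ds) $$ (i, j) = (\<Sum>l<m. M $$ (i, l) * diag_of_list ds $$ (l, j))"
    using assms by (intro mult_mat_entry) auto
  also have "\<dots> = (\<Sum>l<m. if l = j then M $$ (i, l) * ds ! l else 0)"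
    using assms by (intro sum.cong) auto
  finally show ?thesis using assms by simp
qed

context involution_ring begin

text \<open>Lists with the same multiset differ by a permutation of positions, whose permutation
  matrix carries one diagonal to the other.\<close>

lemma diag_reorder:
  assumes "mset xs = mset ys"
  obtains P where "unitary_by cj (length xs) P"
    "adj P * diag_of_list xs * P = diag_of_list ys"
proof -
  obtain f where f: "f permutes {..<length xs}" "permute_list f xs = ys"
    using mset_eq_permutation[OF assms[symmetric]] assms by (metis mset_eq_length)
  then have bij: "bij_betw f {..<length xs} {..<length xs}" by (simp add: permutes_imp_bij)
  obtain P where P: "unitary_by cj (length xs) P"
    "\<And>M. M \<in> carrier_mat (length xs) (length xs) \<Longrightarrow>
      adj P * M * P = mat (length xs) (length xs) (\<lambda>(i, j). M $$ (f i, f j))"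
    using unitary_reindex[OF bij] by metis
  have reindexed: "adj P * diag_of_list xs * P =
      mat (length xs) (length xs) (\<lambda>(i, j). diag_of_list xs $$ (f i, f j))"
    by (rule P(2)) simp
  have "adj P * diag_of_list xs * P = diag_of_list ys"
  proof (rule eq_matI)
    fix i j assume "i < dim_row (diag_of_list ys)" "j < dim_col (diag_of_list ys)"
    then have "i < length xs" "j < length xs" using assms by (auto simp: diag_of_list_def dest: mset_eq_length)
    moreover from this have "ys ! j = xs ! f j"
      using f(2) by (auto simp: permute_list_def)
    moreover from \<open>i < length xs\<close> \<open>j < length xs\<close> have "f i < length xs" "f j < length xs" "f i = f j \<longleftrightarrow> i = j"
      using bij by (auto dest: bij_betwE bij_betw_imp_inj_on inj_onD)
    ultimately show "(adj P * diag_of_list xs * P) $$ (i, j) = diag_of_list ys $$ (i, j)"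
      using mset_eq_length[OF assms] by (auto simp: reindexed)
  qed (use reindexed mset_eq_length[OF assms] in \<open>auto simp: diag_of_list_def\<close>)
  with P(1) show ?thesis by (rule that)
qed

end

section \<open>Quaternion matrices\<close>

text \<open>The squared modulus, taken as a real number so that positivity arguments run in the
  reals.\<close>

definition quat_nsq :: "quat \<Rightarrow> real" where
  "quat_nsq q = (qre q)\<^sup>2 + (qi q)\<^sup>2 + (qj q)\<^sup>2 + (qk q)\<^sup>2"

lemma quat_nsq_nonneg [simp]: "0 \<le> quat_nsq q"
  by (simp add: quat_nsq_def)

lemma quat_nsq_eq_0_iff [simp]: "quat_nsq q = 0 \<longleftrightarrow> q = 0"
  by (auto simp: quat_nsq_def quat_eq_iff zero_quat_def add_nonneg_eq_0_iff)

lemma quat_components [simp]: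
  "qre (p + q) = qre p + qre q" "qi (p + q) = qi p + qi q"
  "qj (p + q) = qj p + qj q" "qk (p + q) = qk p + qk q"
  "qre (r *\<^sub>R q) = r * qre q" "qi (r *\<^sub>R q) = r * qi q"
  "qj (r *\<^sub>R q) = r * qj q" "qk (r *\<^sub>R q) = r * qk q"
  "qre 0 = 0" "qi 0 = 0" "qj 0 = 0" "qk 0 = 0"
  "qre 1 = 1" "qi 1 = 0" "qj 1 = 0" "qk 1 = 0"
  by (simp_all add: quat_arith_defs)

lemma quat_mult_components:
  "qre (x * y) = qre x * qre y - qi x * qi y - qj x * qj y - qk x * qk y"
  "qi (x * y) = qre x * qi y + qi x * qre y + qj x * qk y - qk x * qj y"
  "qj (x * y) = qre x * qj y - qi x * qk y + qj x * qre y + qk x * qi y"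
  "qk (x * y) = qre x * qk y + qi x * qj y - qj x * qi y + qk x * qre y"
  by (simp_all add: times_quat_def)

lemma quat_cnj_components [simp]:
  "qre (quat_cnj q) = qre q" "qi (quat_cnj q) = - qi q"
  "qj (quat_cnj q) = - qj q" "qk (quat_cnj q) = - qk q"
  by (simp_all add: quat_cnj_def)

interpretation quat: involution_ring quat_cnj
  by standard (simp_all add: quat_eq_iff quat_mult_components algebra_simps)

lemma quat_cnj_scaleR [simp]: "quat_cnj (r *\<^sub>R q) = r *\<^sub>R quat_cnj q"
  by (simp add: quat_eq_iff)

lemma quat_cnj_of_real [simp]: "quat_cnj (of_real r) = of_real r"
  by (simp add: of_real_def)

lemma quat_cnj_mult_self: "quat_cnj q * q = of_real (quat_nsq q)" "q * quat_cnj q = of_real (quat_nsq q)"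
  by (simp_all add: quat_eq_iff quat_mult_components of_real_def quat_nsq_def power2_eq_square)

lemma quat_nsq_mult: "quat_nsq (p * q) = quat_nsq p * quat_nsq q"
  by (simp add: quat_nsq_def quat_mult_components power2_eq_square algebra_simps)

lemma quat_nsq_scaleR: "quat_nsq (r *\<^sub>R q) = r\<^sup>2 * quat_nsq q"
  by (simp add: quat_nsq_def power_mult_distrib algebra_simps)

lemma quat_nsq_cnj [simp]: "quat_nsq (quat_cnj q) = quat_nsq q"
  by (simp add: quat_nsq_def)

lemma qre_mult_commute: "qre (p * q) = qre (q * p)"
  by (simp add: quat_mult_components algebra_simps)

lemma qre_sum: "qre (sum f S) = (\<Sum>x\<in>S. qre (f x))"
  by (induction S rule: infinite_finite_induct) auto

lemma qre_of_real [simp]: "qre (of_real r) = r"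
  by (simp add: of_real_def)

text \<open>A determinant-free argument for noncommuting scalars: since
  \<open>adj P * P = 1\<close>, the matrix \<open>E = P * adj P\<close> is a Hermitian idempotent,
  and so is its complement \<open>Q\<close>, whose trace turns out to have real part zero. This
  forces \<open>Q = 0\<close>.\<close>

lemma quat_unitary_right_inverse:
  assumes "unitary_by quat_cnj n P"
  shows "P * quat.adj P = 1\<^sub>m n"
proof -
  have P: "P \<in> carrier_mat n n" and u: "quat.adj P * P = 1\<^sub>m n"
    using assms by (auto simp: unitary_by_def)
  have P': "quat.adj P \<in> carrier_mat n n" using P by simp
  define E where "E = P * quat.adj P"
  have E: "E \<in> carrier_mat n n" using P P' by (auto simp: E_def)
  have "E * E = P * (quat.adj P * (P * quat.adj P))"
    unfolding E_def using P P' by (intro assoc_mult_mat[of _ n n _ n _ n]) auto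
  also have "quat.adj P * (P * quat.adj P) = quat.adj P * P * quat.adj P"
    using P P' by (intro assoc_mult_mat[symmetric, of _ n n _ n _ n]) auto
  finally have EE: "E * E = E" using left_mult_one_mat[OF P'] by (simp only: u E_def[symmetric])
  have adjE: "quat.adj E = E"
    using quat.adj_mult[OF P P'] by (simp add: E_def)
  define Q where "Q = 1\<^sub>m n - E"
  have Q: "Q \<in> carrier_mat n n" using E by (auto simp: Q_def)
  have adjQ: "quat.adj Q = Q"
    using quat.adj_diff[of "1\<^sub>m n" n n E] E by (simp add: Q_def adjE)
  have "Q * Q = Q"
  proof -
    have "Q * Q = (1\<^sub>m n - E) * 1\<^sub>m n - (1\<^sub>m n - E) * E"
      using E unfolding Q_def by (intro mult_minus_distrib_mat[of _ n n _ n]) auto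
    also have "(1\<^sub>m n - E) * E = 1\<^sub>m n * E - E * E"
      using E by (intro minus_mult_distrib_mat[of _ n n _ _ n]) auto
    also have "\<dots> = 0\<^sub>m n n" using E by (simp add: EE)
    finally have "Q * Q = Q * 1\<^sub>m n - 0\<^sub>m n n" by (simp only: Q_def)
    then show ?thesis using Q by (intro eq_matI) auto
  qed
  \<comment> \<open>\<open>Q\<close> is a Hermitian idempotent, so the real part of its trace is the sum of the
    \<open>\<bar>Q\<^sub>i\<^sub>j\<bar>\<^sup>2\<close>; it is also \<open>n\<close> minus that of \<open>P\<^sup>* P\<close>, as the real part of a product is symmetric.\<close>
  then have "(\<Sum>i<n. qre (Q $$ (i, i))) = (\<Sum>i<n. \<Sum>l<n. quat_nsq (Q $$ (l, i)))"
  proof -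
    have "qre (Q $$ (i, i)) = (\<Sum>l<n. quat_nsq (Q $$ (l, i)))" if "i < n" for i
    proof -
      have "Q $$ (i, i) = (quat.adj Q * Q) $$ (i, i)" by (simp add: adjQ \<open>Q * Q = Q\<close>)
      also have "\<dots> = (\<Sum>l<n. quat.adj Q $$ (i, l) * Q $$ (l, i))"
        using Q that by (intro mult_mat_entry[of _ n n _ n]) auto
      also have "\<dots> = (\<Sum>l<n. of_real (quat_nsq (Q $$ (l, i))))"
        using Q that by (intro sum.cong) (auto simp: quat_cnj_mult_self)
      finally show ?thesis by (simp add: qre_sum)
    qed
    then show ?thesis by simp
  qed
  moreover have "(\<Sum>i<n. qre (Q $$ (i, i))) = 0"
  proof -
    have "(\<Sum>i<n. qre (E $$ (i, i))) = (\<Sum>i<n. \<Sum>l<n. qre (P $$ (i, l) * quat.adj P $$ (l, i)))"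
      using mult_mat_entry[OF P P'] by (simp add: E_def qre_sum)
    also have "\<dots> = (\<Sum>l<n. \<Sum>i<n. qre (quat.adj P $$ (l, i) * P $$ (i, l)))"
      by (subst sum.swap) (simp add: qre_mult_commute)
    also have "\<dots> = (\<Sum>l<n. qre ((quat.adj P * P) $$ (l, l)))"
      using mult_mat_entry[OF P' P] by (simp add: qre_sum)
    finally have "(\<Sum>i<n. qre (E $$ (i, i))) = (\<Sum>l<n. 1)" by (simp add: u)
    moreover have "qre (Q $$ (i, i)) = 1 - qre (E $$ (i, i))" if "i < n" for i
      using E that by (simp add: Q_def minus_quat_def)
    ultimately show ?thesis by (simp add: sum_subtractf)
  qed
  ultimately have "(\<Sum>i<n. \<Sum>l<n. quat_nsq (Q $$ (l, i))) = 0" by simp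
  then have "Q $$ (l, i) = 0" if "l < n" "i < n" for l i
    using that by (simp add: sum_nonneg_eq_0_iff sum_nonneg)
  then have "E $$ (l, i) = 1\<^sub>m n $$ (l, i)" if "l < n" "i < n" for l i
    using that E by (fastforce simp: Q_def)
  then show ?thesis
    using E by (intro eq_matI) (auto simp: E_def[symmetric])
qed

section \<open>Real eigenvalues, Householder reflections and deflation\<close>

definition is_eigenvector :: "nat \<Rightarrow> quat mat \<Rightarrow> (nat \<Rightarrow> quat) \<Rightarrow> real \<Rightarrow> bool" where
  "is_eigenvector n A x r \<longleftrightarrow> (\<exists>i<n. x i \<noteq> 0) \<and> (\<forall>i<n. (\<Sum>l<n. A $$ (i, l) * x l) = r *\<^sub>R x i)"

text \<open>As eigenvalues are real, right multiplication by a nonzero quaternion preserves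
  eigenvectors. Here it normalizes the vector and also rotates coordinate 0 to a nonnegative real
  \<open>c\<close>, which keeps the quantity \<open>1 + c\<close> in the Householder reflection away
  from zero.\<close>

lemma unit_multiple:
  fixes x :: "nat \<Rightarrow> quat"
  assumes "\<exists>i<n. x i \<noteq> 0"
  obtains q c where "(\<Sum>i<n. quat_nsq (x i * q)) = 1" "x 0 * q = of_real c" "0 \<le> c"
proof -
  define N where "N = (\<Sum>i<n. quat_nsq (x i))"
  obtain k where k: "k < n" "x k \<noteq> 0" using assms by blast
  have "0 < quat_nsq (x k)" using k by (simp add: less_le)
  then have N: "N > 0"
    unfolding N_def using k by (intro sum_pos2[of _ k]) auto
  \<comment> \<open>\<open>p\<close> is the conjugate direction of \<open>x 0\<close>, so that
    \<open>x 0 * p\<close> is the modulus of \<open>x 0\<close>; for \<open>x 0 = 0\<close> any unit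
    quaternion serves, and 1 is taken.\<close>
  define p where "p = (if x 0 = 0 then 1 else (1 / sqrt (quat_nsq (x 0))) *\<^sub>R quat_cnj (x 0))"
  have "quat_nsq p = 1"
    by (auto simp: p_def quat_nsq_scaleR power_divide) (simp add: quat_nsq_def)
  moreover define q where "q = (1 / sqrt N) *\<^sub>R p"
  ultimately have q: "quat_nsq q = 1 / N"
    using N by (simp add: quat_nsq_scaleR power_divide)
  have "x 0 * q = of_real (sqrt (quat_nsq (x 0)) / sqrt N)"
  proof (cases "x 0 = 0")
    case False
    then have "x 0 * q = of_real (1 / sqrt N * (1 / sqrt (quat_nsq (x 0))) * quat_nsq (x 0))"
      by (simp add: q_def p_def quat_cnj_mult_self of_real_def)
    also have "1 / sqrt N * (1 / sqrt (quat_nsq (x 0))) * quat_nsq (x 0) =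
        quat_nsq (x 0) / sqrt (quat_nsq (x 0)) / sqrt N"
      by simp
    also have "\<dots> = sqrt (quat_nsq (x 0)) / sqrt N"
      by (simp only: real_div_sqrt quat_nsq_nonneg)
    finally show ?thesis .
  qed (simp add: quat_nsq_def)
  moreover have "(\<Sum>i<n. quat_nsq (x i * q)) = 1"
    using N by (simp add: quat_nsq_mult q sum_divide_distrib[symmetric] N_def[symmetric])
  ultimately show ?thesis
    using N by (intro that[of q "sqrt (quat_nsq (x 0)) / sqrt N"]) auto
qed

text \<open>Householder reflection: if \<open>w\<close> is a suitable multiple of
  \<open>x q + e_0\<close> with \<open>adj w * w = 2\<close>, then \<open>1 - w * adj w\<close> is
  unitary and sends the first unit vector \<open>e_0\<close> to \<open>- x q\<close>. Hence the
  multiplier obtained is the negative of the \<open>q\<close> that normalizes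
  \<open>x\<close>.\<close>

lemma unitary_with_first_column:
  fixes x :: "nat \<Rightarrow> quat"
  assumes "\<exists>i<n. x i \<noteq> 0"
  obtains H q where "unitary_by quat_cnj n H" "\<And>i. i < n \<Longrightarrow> H $$ (i, 0) = x i * q"
proof -
  obtain q c where q: "(\<Sum>i<n. quat_nsq (x i * q)) = 1" "x 0 * q = of_real c" "0 \<le> c"
    using unit_multiple[OF assms] by metis
  have n: "0 < n" using assms by auto
  \<comment> \<open>The vector \<open>x q + e_0\<close> has squared length
    \<open>2 * (1 + c)\<close>, so this factor gives \<open>w\<close> squared length 2.\<close>
  define s where "s = 1 / sqrt (1 + c)"
  have s: "s * s * (1 + c) = 1" using q(3) by (simp add: s_def)
  define w where "w i = s *\<^sub>R (x i * q + (if i = 0 then 1 else 0))" for i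
  define d :: "nat \<Rightarrow> nat \<Rightarrow> quat" where "d i j = (if i = j then 1 else 0)" for i j
  define H where "H = mat n n (\<lambda>(i, j). d i j - w i * quat_cnj (w j))"
  have "(\<Sum>l<n. quat_nsq (w l)) = 2"
  proof -
    have "quat_nsq (w l) = s * s * (quat_nsq (x l * q) + (if l = 0 then 2 * c + 1 else 0))" for l
    proof (cases "l = 0")
      case True
      then show ?thesis
        using q(2) by (simp add: w_def quat_nsq_scaleR power2_eq_square)
          (simp add: quat_nsq_def of_real_def power2_eq_square algebra_simps)
    qed (simp add: w_def quat_nsq_scaleR power2_eq_square)
    then have "(\<Sum>l<n. quat_nsq (w l)) = s * s * (1 + (2 * c + 1))"
      using n q(1) by (simp add: sum_distrib_left[symmetric] sum.distrib)
    also have "\<dots> = 2 * (s * s * (1 + c))" by (simp add: algebra_simps)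
    finally show ?thesis by (simp add: s)
  qed
  then have w: "(\<Sum>l<n. quat_cnj (w l) * w l) = 2"
    by (simp add: quat_cnj_mult_self of_real_sum[symmetric] del: of_real_sum)
  have H: "H \<in> carrier_mat n n" by (simp add: H_def)
  have "(quat.adj H * H) $$ (i, j) = d i j" if ij: "i < n" "j < n" for i j
  proof -
    have "(quat.adj H * H) $$ (i, j) = (\<Sum>l<n. quat.adj H $$ (i, l) * H $$ (l, j))"
      using H ij by (intro mult_mat_entry) auto
    also have "\<dots> = (\<Sum>l<n. (d l i - w i * quat_cnj (w l)) * (d l j - w l * quat_cnj (w j)))"
      using ij H by (intro sum.cong) (auto simp: H_def quat.cj_diff quat.cj_mult d_def)
    \<comment> \<open>Expanding leaves \<open>1 - 2 w adj w + w (adj w * w) adj w\<close>, where the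
      last two terms cancel because \<open>adj w * w = 2\<close>.\<close>
    also have "\<dots> = (\<Sum>l<n. (if l = i then d i j - w i * quat_cnj (w j) else 0)
        - (if l = j then w i * quat_cnj (w j) else 0)
        + w i * (quat_cnj (w l) * w l) * quat_cnj (w j))"
      by (intro sum.cong) (auto simp: d_def algebra_simps)
    also have "\<dots> = (d i j - w i * quat_cnj (w j)) - w i * quat_cnj (w j)
        + w i * (\<Sum>l<n. quat_cnj (w l) * w l) * quat_cnj (w j)"
      using ij by (simp add: sum.distrib sum_subtractf sum_distrib_left sum_distrib_right)
    also have "\<dots> = d i j" by (simp add: w mult_2 mult_2_right algebra_simps)
    finally show ?thesis .
  qed
  then have "unitary_by quat_cnj n H"
    using H by (auto simp: unitary_by_def d_def intro!: eq_matI)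
  moreover have "H $$ (i, 0) = x i * (- q)" if i: "i < n" for i
  proof -
    have "quat_cnj (w 0) = of_real (s * (1 + c))"
      using q(2) by (simp add: w_def of_real_def quat_eq_iff)
    then have "w i * quat_cnj (w 0) = (s * s * (1 + c)) *\<^sub>R (x i * q + d i 0)"
      by (simp add: w_def of_real_def d_def algebra_simps)
    then show ?thesis using i n by (simp add: H_def s)
  qed
  ultimately show ?thesis by (rule that)
qed

text \<open>The reflection depends on \<open>x\<close> alone, so one \<open>H\<close> can split off
  a common eigenvector of several matrices. As \<open>r\<close> is real, the first column of
  \<open>H\<close>, a right multiple of \<open>x\<close>, is again an eigenvector; this fixes the
  first column of the congruent matrix, and hermiticity fixes its first row.\<close>

lemma eigenvector_deflation:
  assumes "\<exists>i<Suc k. x i \<noteq> 0"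
  obtains H where "unitary_by quat_cnj (Suc k) H"
    "\<And>A r. A \<in> carrier_mat (Suc k) (Suc k) \<Longrightarrow> quat.adj A = A \<Longrightarrow> is_eigenvector (Suc k) A x r \<Longrightarrow>
      \<exists>A'. A' \<in> carrier_mat k k \<and> quat.adj A' = A' \<and>
        quat.adj H * A * H = four_block_mat (mat 1 1 (\<lambda>_. of_real r)) (0\<^sub>m 1 k) (0\<^sub>m k 1) A'"
proof -
  define n where "n = Suc k"
  obtain H q where uH: "unitary_by quat_cnj n H" and col: "\<And>i. i < n \<Longrightarrow> H $$ (i, 0) = x i * q"
    using unitary_with_first_column[of n x] assms unfolding n_def by metis
  have H: "H \<in> carrier_mat n n" and HH: "quat.adj H * H = 1\<^sub>m n"
    using uH by (auto simp: unitary_by_def)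
  have "\<exists>A'. A' \<in> carrier_mat k k \<and> quat.adj A' = A' \<and>
      quat.adj H * A * H = four_block_mat (mat 1 1 (\<lambda>_. of_real r)) (0\<^sub>m 1 k) (0\<^sub>m k 1) A'"
    if A: "A \<in> carrier_mat n n" and herm: "quat.adj A = A" and eig: "is_eigenvector n A x r" for A r
  proof -
    define M where "M = quat.adj H * A * H"
    have M: "M \<in> carrier_mat n n"
      unfolding M_def using H A by (metis adjoint_by_carrier mult_carrier_mat)
    have hermM: "quat.adj M = M"
      unfolding M_def using quat.adj_congruence[OF A H] herm by simp
    have AH: "(A * H) $$ (i, 0) = r *\<^sub>R H $$ (i, 0)" if "i < n" for i
    proof -
      have "(A * H) $$ (i, 0) = (\<Sum>l<n. A $$ (i, l) * x l * q)"
        using mult_mat_entry[OF A H that, of 0] col by (simp add: n_def mult.assoc)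
      then show ?thesis
        using eig that col[OF that] by (simp add: is_eigenvector_def sum_distrib_right[symmetric])
    qed
    have "M = quat.adj H * (A * H)"
      unfolding M_def using A H by (intro assoc_mult_mat[of _ n n _ n _ n]) auto
    then have col0: "M $$ (i, 0) = (if i = 0 then of_real r else 0)" if "i < n" for i
    proof -
      assume M_eq: "M = quat.adj H * (A * H)"
      have "M $$ (i, 0) = (\<Sum>l<n. quat.adj H $$ (i, l) * (A * H) $$ (l, 0))"
        unfolding M_eq using H A that
        by (intro mult_mat_entry[of _ n n _ n]) (auto simp: n_def)
      also have "\<dots> = r *\<^sub>R (\<Sum>l<n. quat.adj H $$ (i, l) * H $$ (l, 0))"
        by (simp add: AH scaleR_sum_right)
      also have "(\<Sum>l<n. quat.adj H $$ (i, l) * H $$ (l, 0)) = (quat.adj H * H) $$ (i, 0)"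
        using H that by (intro mult_mat_entry[of _ n n _ n, symmetric]) (auto simp: n_def)
      finally show ?thesis using that by (simp add: HH of_real_def n_def)
    qed
    have row0: "M $$ (0, j) = (if j = 0 then of_real r else 0)" if "j < n" for j
    proof -
      have "M $$ (0, j) = quat.adj M $$ (0, j)" by (simp add: hermM)
      also have "\<dots> = quat_cnj (M $$ (j, 0))" using M that by (intro adjoint_by_entry) (auto simp: n_def)
      finally show ?thesis using col0[OF that] by simp
    qed
    define A' where "A' = mat k k (\<lambda>(i, j). M $$ (Suc i, Suc j))"
    have "quat_cnj (M $$ (j, i)) = M $$ (i, j)" if "i < n" "j < n" for i j
      using arg_cong[OF hermM, of "\<lambda>X. X $$ (i, j)"] M that by simp
    then have "quat.adj A' = A'"
      by (intro eq_matI) (auto simp: A'_def n_def)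
    moreover have "M = four_block_mat (mat 1 1 (\<lambda>_. of_real r)) (0\<^sub>m 1 k) (0\<^sub>m k 1) A'"
      using M row0 col0 by (intro eq_matI) (auto simp: A'_def n_def)
    moreover have "A' \<in> carrier_mat k k" by (simp add: A'_def)
    ultimately show ?thesis unfolding M_def[symmetric] by blast
  qed
  then show ?thesis using that[OF uH[unfolded n_def]] unfolding n_def by blast
qed

text \<open>The complex matrix \<open>M\<close> has an eigenvalue \<open>e\<close>, which yields
  \<open>A x = x E\<close> with \<open>e\<close> read as a quaternion \<open>E\<close> acting from
  the right. The form \<open>adj x A x\<close> is self-conjugate and equals \<open>N E\<close> with
  \<open>N > 0\<close>, which forces \<open>E\<close> to be real.\<close>

lemma quat_hermitian_eigenvector:
  assumes A: "A \<in> carrier_mat n n" and herm: "quat.adj A = A" and n: "0 < n"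
  obtains x r where "is_eigenvector n A x r"
proof -
  \<comment> \<open>A quaternion is written as \<open>z + w j\<close> when it is an entry of \<open>A\<close>, and as \<open>u - j t\<close> when it is
    a coordinate of the eigenvector, since the complex eigenvalue acts from the right.\<close>
  define Z where "Z = mat n n (\<lambda>(i, j). Complex (qre (A $$ (i, j))) (qi (A $$ (i, j))))"
  define W where "W = mat n n (\<lambda>(i, j). Complex (qj (A $$ (i, j))) (qk (A $$ (i, j))))"
  define W' where "W' = mat n n (\<lambda>(i, j). - cnj (W $$ (i, j)))"
  define Z' where "Z' = mat n n (\<lambda>(i, j). cnj (Z $$ (i, j)))"
  have c: "Z \<in> carrier_mat n n" "W \<in> carrier_mat n n" "W' \<in> carrier_mat n n" "Z' \<in> carrier_mat n n"
    by (simp_all add: Z_def W_def Z'_def W'_def)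
  define M where "M = four_block_mat Z W W' Z'"
  have M: "M \<in> carrier_mat (n + n) (n + n)" unfolding M_def using c by (intro four_block_carrier_mat)
  obtain e v where "eigenvector M v e"
    using spectrum_non_empty[OF M] n unfolding spectrum_def eigenvalue_def by auto
  then have v: "v \<in> carrier_vec (n + n)" "v \<noteq> 0\<^sub>v (n + n)" "M *\<^sub>v v = e \<cdot>\<^sub>v v"
    using M by (auto simp: eigenvector_def)
  define u where "u = vec_first v n"
  define t where "t = vec_last v n"
  have ut: "u \<in> carrier_vec n" "t \<in> carrier_vec n" "v = u @\<^sub>v t"
    using v(1) by (simp_all add: u_def t_def)
  have eq: "(Z *\<^sub>v u + W *\<^sub>v t) @\<^sub>v (W' *\<^sub>v u + Z' *\<^sub>v t) = e \<cdot>\<^sub>v (u @\<^sub>v t)"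
    using v(3) four_block_mat_mult_vec[OF c ut(1,2)] by (simp add: M_def ut(3))
  have mult_entry: "(X *\<^sub>v y) $ i = (\<Sum>l<n. X $$ (i, l) * y $ l)"
    if "X \<in> carrier_mat n n" "y \<in> carrier_vec n" "i < n" for X :: "complex mat" and y i
    using that by (auto simp: scalar_prod_def atLeast0LessThan intro!: sum.cong)
  have eq1: "(\<Sum>l<n. Z $$ (i, l) * u $ l) + (\<Sum>l<n. W $$ (i, l) * t $ l) = e * u $ i" if "i < n" for i
    using arg_cong[OF eq, of "\<lambda>y. y $ i"] that c ut(1,2)
    by (simp add: mult_entry[symmetric] del: index_mult_mat_vec)
  have eq2: "(\<Sum>l<n. W' $$ (i, l) * u $ l) + (\<Sum>l<n. Z' $$ (i, l) * t $ l) = e * t $ i" if "i < n" for i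
    using arg_cong[OF eq, of "\<lambda>y. y $ (n + i)"] that c ut(1,2)
    by (simp add: mult_entry[symmetric] del: index_mult_mat_vec)
  define x where "x i = Quat (Re (u $ i)) (Im (u $ i)) (- Re (t $ i)) (Im (t $ i))" for i
  define E where "E = Quat (Re e) (Im e) 0 0"
  have AE: "(\<Sum>l<n. A $$ (i, l) * x l) = x i * E" if i: "i < n" for i
  proof -
    have "qi (sum f S) = (\<Sum>x\<in>S. qi (f x))" "qj (sum f S) = (\<Sum>x\<in>S. qj (f x))"
      "qk (sum f S) = (\<Sum>x\<in>S. qk (f x))" for f and S :: "nat set"
      by (induction S rule: infinite_finite_induct, auto)+
    note sums = qre_sum this
    \<comment> \<open>The first two components of the product come from the upper block row of
      \<open>M\<close>, the last two from the lower one; the sign at \<open>qj\<close> reflects the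
      convention \<open>u - j t\<close>.\<close>
    have "qre (A $$ (i, l) * x l) = Re (Z $$ (i, l) * u $ l + W $$ (i, l) * t $ l)"
      "qi (A $$ (i, l) * x l) = Im (Z $$ (i, l) * u $ l + W $$ (i, l) * t $ l)"
      "qj (A $$ (i, l) * x l) = - Re (W' $$ (i, l) * u $ l + Z' $$ (i, l) * t $ l)"
      "qk (A $$ (i, l) * x l) = Im (W' $$ (i, l) * u $ l + Z' $$ (i, l) * t $ l)" if "l < n" for l
      using i that by (simp_all add: x_def quat_mult_components Z_def W_def Z'_def W'_def)
    then have "qre (\<Sum>l<n. A $$ (i, l) * x l) = Re (\<Sum>l<n. Z $$ (i, l) * u $ l + W $$ (i, l) * t $ l)"
      "qi (\<Sum>l<n. A $$ (i, l) * x l) = Im (\<Sum>l<n. Z $$ (i, l) * u $ l + W $$ (i, l) * t $ l)"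
      "qj (\<Sum>l<n. A $$ (i, l) * x l) = - Re (\<Sum>l<n. W' $$ (i, l) * u $ l + Z' $$ (i, l) * t $ l)"
      "qk (\<Sum>l<n. A $$ (i, l) * x l) = Im (\<Sum>l<n. W' $$ (i, l) * u $ l + Z' $$ (i, l) * t $ l)"
      unfolding sums Re_sum Im_sum sum_negf[symmetric] by (auto intro!: sum.cong)
    then have "qre (\<Sum>l<n. A $$ (i, l) * x l) = Re (e * u $ i)"
      "qi (\<Sum>l<n. A $$ (i, l) * x l) = Im (e * u $ i)"
      "qj (\<Sum>l<n. A $$ (i, l) * x l) = - Re (e * t $ i)"
      "qk (\<Sum>l<n. A $$ (i, l) * x l) = Im (e * t $ i)"
      by (simp_all only: eq1[OF i, symmetric] eq2[OF i, symmetric] sum.distrib)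
    then show ?thesis
      by (simp add: quat_eq_iff quat_mult_components x_def E_def algebra_simps)
  qed
  obtain k where k: "k < n" "x k \<noteq> 0"
  proof -
    have "\<exists>i<n. u $ i \<noteq> 0 \<or> t $ i \<noteq> 0"
    proof (rule ccontr)
      assume "\<not> ?thesis"
      then have "v = 0\<^sub>v (n + n)"
        using ut by (intro eq_vecI) auto
      then show False using v(2) by simp
    qed
    then show ?thesis
      using that by (auto simp: x_def zero_quat_def complex_eq_iff)
  qed
  define N where "N = (\<Sum>i<n. quat_nsq (x i))"
  have "0 < quat_nsq (x k)" using k by (simp add: less_le)
  then have N: "N > 0"
    unfolding N_def using k by (intro sum_pos2[of _ k]) auto
  have "(\<Sum>i<n. quat_cnj (x i) * (\<Sum>l<n. A $$ (i, l) * x l)) = of_real N * E"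
    by (simp add: AE N_def mult.assoc[symmetric] quat_cnj_mult_self sum_distrib_right)
  moreover have "quat_cnj (\<Sum>i<n. quat_cnj (x i) * (\<Sum>l<n. A $$ (i, l) * x l)) =
      (\<Sum>i<n. quat_cnj (x i) * (\<Sum>l<n. A $$ (i, l) * x l))"
  proof -
    have "quat_cnj (A $$ (i, l)) = A $$ (l, i)" if "i < n" "l < n" for i l
      using arg_cong[OF herm, of "\<lambda>X. X $$ (l, i)"] A that by simp
    then show ?thesis
      by (simp add: quat.cj_sum quat.cj_mult sum_distrib_left sum_distrib_right mult.assoc)
        (subst sum.swap, simp)
  qed
  ultimately have "quat_cnj (of_real N * E) = of_real N * E" by simp
  then have "N * Im e = 0"
    by (simp add: quat_eq_iff E_def of_real_def)
  then have "E = of_real (Re e)" using N by (simp add: E_def of_real_def quat_eq_iff)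
  then have "is_eigenvector n A x (Re e)"
    using AE k by (auto simp: is_eigenvector_def of_real_def)
  then show ?thesis by (rule that)
qed

section \<open>Spectral theorem for commuting Hermitian quaternion matrices\<close>

context involution_ring begin

text \<open>The inductive step of both spectral theorems: a diagonalizing \<open>V\<close> for the
  lower block, bordered by 1, leaves the split-off entry \<open>d\<close> alone.\<close>

lemma block_diag_congruence:
  assumes A: "A \<in> carrier_mat k k" and V: "V \<in> carrier_mat k k"
  defines "B \<equiv> four_block_mat (1\<^sub>m 1) (0\<^sub>m 1 k) (0\<^sub>m k 1) V"
  shows "adj B * four_block_mat (mat 1 1 (\<lambda>_. d)) (0\<^sub>m 1 k) (0\<^sub>m k 1) A * B =
    four_block_mat (mat 1 1 (\<lambda>_. d)) (0\<^sub>m 1 k) (0\<^sub>m k 1) (adj V * A * V)"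
proof -
  have D: "mat 1 1 (\<lambda>_. d) \<in> carrier_mat 1 1" and O: "0\<^sub>m 1 k \<in> carrier_mat 1 k" "0\<^sub>m k 1 \<in> carrier_mat k 1"
    and I: "1\<^sub>m 1 \<in> carrier_mat 1 1" and V': "adj V \<in> carrier_mat k k" and V'A: "adj V * A \<in> carrier_mat k k"
    using V A mult_carrier_mat[of "adj V" k k A k] by auto
  have "adj B = four_block_mat (1\<^sub>m 1) (0\<^sub>m 1 k) (0\<^sub>m k 1) (adj V)"
    unfolding B_def by (subst adj_four_block[OF I O V]) simp
  moreover have "four_block_mat (1\<^sub>m 1) (0\<^sub>m 1 k) (0\<^sub>m k 1) (adj V) *
      four_block_mat (mat 1 1 (\<lambda>_. d)) (0\<^sub>m 1 k) (0\<^sub>m k 1) A =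
      four_block_mat (mat 1 1 (\<lambda>_. d)) (0\<^sub>m 1 k) (0\<^sub>m k 1) (adj V * A)"
    by (subst mult_four_block_mat[OF I O V' D O A])
      (use V' A V'A in \<open>simp add: right_mult_zero_mat[OF V'] left_mult_one_mat[OF D]
        left_add_zero_mat[OF V'A] right_add_zero_mat[OF D]\<close>)
  moreover have "four_block_mat (mat 1 1 (\<lambda>_. d)) (0\<^sub>m 1 k) (0\<^sub>m k 1) (adj V * A) * B =
      four_block_mat (mat 1 1 (\<lambda>_. d)) (0\<^sub>m 1 k) (0\<^sub>m k 1) (adj V * A * V)"
    unfolding B_def
    by (subst mult_four_block_mat[OF D O V'A I O V])
      (use V V'A mult_carrier_mat[OF V'A V] in \<open>simp add: right_mult_zero_mat[OF V'A]
        right_mult_zero_mat[OF D] right_mult_one_mat[OF D] right_add_zero_mat[OF D]\<close>)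
  ultimately show ?thesis by simp
qed

text \<open>The block congruence applied to \<open>d = 1\<close> and the identity as lower
  block.\<close>

lemma block_diag_unitary:
  assumes "unitary_by cj k V"
  shows "unitary_by cj (Suc k) (four_block_mat (1\<^sub>m 1) (0\<^sub>m 1 k) (0\<^sub>m k 1) V)"
proof -
  define B where "B = four_block_mat (1\<^sub>m 1) (0\<^sub>m 1 k) (0\<^sub>m k 1) V"
  have V: "V \<in> carrier_mat k k" and VV: "adj V * V = 1\<^sub>m k"
    using assms by (auto simp: unitary_by_def)
  have B: "B \<in> carrier_mat (Suc k) (Suc k)"
    unfolding B_def using four_block_carrier_mat[of "1\<^sub>m 1" 1 1 V k k] V by simp
  have I: "four_block_mat (mat 1 1 (\<lambda>_. 1)) (0\<^sub>m 1 k) (0\<^sub>m k 1) (1\<^sub>m k) = (1\<^sub>m (Suc k) :: 'a mat)"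
    by (rule eq_matI) auto
  have "adj B * 1\<^sub>m (Suc k) * B = four_block_mat (mat 1 1 (\<lambda>_. 1)) (0\<^sub>m 1 k) (0\<^sub>m k 1) (adj V * 1\<^sub>m k * V)"
    unfolding B_def I[symmetric] by (rule block_diag_congruence) (use V in auto)
  also have "adj B * 1\<^sub>m (Suc k) = adj B"
    using B by (intro right_mult_one_mat[of _ "Suc k" "Suc k"]) simp
  also have "adj V * 1\<^sub>m k * V = 1\<^sub>m k"
    using V by (simp add: right_mult_one_mat[of _ k k] VV)
  finally have "adj B * B = 1\<^sub>m (Suc k)" by (simp only: I)
  then show ?thesis using B by (simp add: unitary_by_def B_def)
qed

end

section \<open>Congruence by matrices whose adjoint is a right inverse\<close>

context involution_ring begin

lemma mult_adj_cancel:
  assumes "V \<in> carrier_mat n n" "V * adj V = 1\<^sub>m n" "X \<in> carrier_mat n n"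
  shows "V * (adj V * X) = X"
  using assms assoc_mult_mat[of V n n "adj V" n X n] by simp

text \<open>The inner factors \<open>V * adj V\<close> cancel, so congruence is multiplicative; in
  particular it keeps commuting matrices commuting.\<close>

lemma congruence_product:
  assumes V: "V \<in> carrier_mat n n" "V * adj V = 1\<^sub>m n"
    and A: "A \<in> carrier_mat n n" and C: "C \<in> carrier_mat n n"
  shows "(adj V * A * V) * (adj V * C * V) = adj V * (A * C) * V"
  by (simp add: V A C mult_carrier_mat[of _ n n _ n] assoc_mult_mat[of _ n n _ n _ n] mult_adj_cancel[OF V])

lemma mult_congruence:
  assumes V: "V \<in> carrier_mat n n" "V * adj V = 1\<^sub>m n" and A: "A \<in> carrier_mat n n"
  shows "V * (adj V * A * V) = A * V"
  by (simp add: V A mult_carrier_mat[of _ n n _ n] assoc_mult_mat[of _ n n _ n _ n] mult_adj_cancel[OF V])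

end

lemmas quat_congruence_product =
  quat.congruence_product[OF unitary_by_carrier quat_unitary_right_inverse]

text \<open>With \<open>M = adj V A V\<close> one has \<open>V M = A V\<close>, so
  \<open>V z\<close> satisfies the eigenvalue equation for \<open>A\<close>; it is nonzero because
  \<open>adj V\<close> recovers \<open>z\<close> from it.\<close>

lemma is_eigenvector_congruence:
  assumes V: "unitary_by quat_cnj n V" and A: "A \<in> carrier_mat n n"
    and eig: "is_eigenvector n (quat.adj V * A * V) z r"
  shows "is_eigenvector n A (\<lambda>i. \<Sum>l<n. V $$ (i, l) * z l) r"
proof -
  have Vc: "V \<in> carrier_mat n n" "quat.adj V \<in> carrier_mat n n" "quat.adj V * V = 1\<^sub>m n"
    using V by (auto simp: unitary_by_def)
  have M: "quat.adj V * A * V \<in> carrier_mat n n"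
    using Vc A by (metis mult_carrier_mat)
  have assoc: "(\<Sum>l<n. X $$ (i, l) * (\<Sum>m<n. Y $$ (l, m) * z m)) = (\<Sum>m<n. (X * Y) $$ (i, m) * z m)"
    if "X \<in> carrier_mat n n" "Y \<in> carrier_mat n n" "i < n" for X Y i
  proof -
    have "(\<Sum>m<n. (X * Y) $$ (i, m) * z m) = (\<Sum>m<n. \<Sum>l<n. X $$ (i, l) * (Y $$ (l, m) * z m))"
      using mult_mat_entry[OF that(1,2,3)]
      by (intro sum.cong) (auto simp: sum_distrib_right mult.assoc)
    then show ?thesis by (subst (asm) sum.swap) (simp add: sum_distrib_left)
  qed
  have "(\<Sum>l<n. A $$ (i, l) * (\<Sum>m<n. V $$ (l, m) * z m)) = r *\<^sub>R (\<Sum>l<n. V $$ (i, l) * z l)"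
    if i: "i < n" for i
  proof -
    have "(\<Sum>l<n. A $$ (i, l) * (\<Sum>m<n. V $$ (l, m) * z m)) = (\<Sum>m<n. (A * V) $$ (i, m) * z m)"
      using A Vc(1) i by (rule assoc)
    also have "\<dots> = (\<Sum>m<n. (V * (quat.adj V * A * V)) $$ (i, m) * z m)"
      by (simp only: quat.mult_congruence[OF Vc(1) quat_unitary_right_inverse[OF V] A])
    also have "\<dots> = (\<Sum>l<n. V $$ (i, l) * (\<Sum>m<n. (quat.adj V * A * V) $$ (l, m) * z m))"
      using Vc(1) M i by (rule assoc[symmetric])
    also have "\<dots> = (\<Sum>l<n. V $$ (i, l) * (r *\<^sub>R z l))"
      using eig by (intro sum.cong refl arg_cong2[of _ _ _ _ times]) (simp add: is_eigenvector_def)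
    finally show ?thesis by (simp add: scaleR_sum_right)
  qed
  moreover have "\<exists>i<n. (\<Sum>l<n. V $$ (i, l) * z l) \<noteq> 0"
  proof (rule ccontr)
    assume "\<not> ?thesis"
    then have "(\<Sum>l<n. quat.adj V $$ (i, l) * (\<Sum>m<n. V $$ (l, m) * z m)) = 0" for i by simp
    then have "(\<Sum>m<n. 1\<^sub>m n $$ (i, m) * z m) = 0" if "i < n" for i
      using assoc[OF Vc(2,1) that] Vc(3) by simp
    moreover have "(\<Sum>m<n. 1\<^sub>m n $$ (i, m) * z m) = (\<Sum>m<n. if m = i then z m else 0)" if "i < n" for i
      using that by (intro sum.cong) auto
    ultimately have "z i = 0" if "i < n" for i using that by simp
    then show False using eig by (auto simp: is_eigenvector_def)
  qed
  ultimately show ?thesis by (simp add: is_eigenvector_def)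
qed

text \<open>Induction on the size: an eigenvector splits off a 1 by 1 block, and the remaining block
  is again Hermitian.\<close>

lemma quat_spectral:
  assumes "A \<in> carrier_mat n n" "quat.adj A = A"
  shows "\<exists>V ds. unitary_by quat_cnj n V \<and> length ds = n \<and>
    quat.adj V * A * V = diag_of_list (map of_real ds)"
  using assms
proof (induction n arbitrary: A)
  case 0
  then show ?case
    by (intro exI[of _ "1\<^sub>m 0"] exI[of _ "[]"]) (auto simp: unitary_by_def diag_of_list_def intro!: eq_matI)
next
  case (Suc k)
  obtain x r where eig: "is_eigenvector (Suc k) A x r"
    using quat_hermitian_eigenvector[OF Suc.prems] by auto
  then have "\<exists>i<Suc k. x i \<noteq> 0" by (simp add: is_eigenvector_def)
  then obtain H A' where H: "unitary_by quat_cnj (Suc k) H"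
    and A': "A' \<in> carrier_mat k k" "quat.adj A' = A'"
      "quat.adj H * A * H = four_block_mat (mat 1 1 (\<lambda>_. of_real r)) (0\<^sub>m 1 k) (0\<^sub>m k 1) A'"
    using eigenvector_deflation Suc.prems eig by metis
  obtain V ds where V: "unitary_by quat_cnj k V" "length ds = k"
    "quat.adj V * A' * V = diag_of_list (map of_real ds)"
    using Suc.IH[OF A'(1,2)] by metis
  define B where "B = four_block_mat (1\<^sub>m 1) (0\<^sub>m 1 k) (0\<^sub>m k 1) V"
  have B: "unitary_by quat_cnj (Suc k) B"
    unfolding B_def by (rule quat.block_diag_unitary[OF V(1)])
  have "quat.adj (H * B) * A * (H * B) = quat.adj B * (quat.adj H * A * H) * B"
    using Suc.prems(1) H B by (intro quat.congruence_mult) (auto simp: unitary_by_def)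
  also have "\<dots> = diag_of_list (map of_real (r # ds))"
    using quat.block_diag_congruence[OF A'(1), of V "of_real r"] V
    by (simp add: A'(3) B_def unitary_by_def diag_of_list_Cons)
  finally show ?case
    using quat.unitary_mult[OF H B] V(2) by (intro exI[of _ "H * B"] exI[of _ "r # ds"]) simp
qed

text \<open>Commutation with the diagonal form of \<open>A\<close> makes \<open>C2\<close> vanish
  between different eigenvalues of \<open>A\<close>. Cutting an eigenvector of \<open>C2\<close>
  down to one eigenspace of \<open>A\<close> therefore keeps it an eigenvector.\<close>

lemma quat_common_eigenvector:
  assumes A: "A \<in> carrier_mat n n" "quat.adj A = A" and C: "C \<in> carrier_mat n n" "quat.adj C = C"
    and comm: "A * C = C * A" and n: "0 < n"
  obtains x r s where "is_eigenvector n A x r" "is_eigenvector n C x s"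
proof -
  obtain V ds where V: "unitary_by quat_cnj n V" and ds: "length ds = n"
    and D: "quat.adj V * A * V = diag_of_list (map of_real ds)"
    using quat_spectral[OF A] by metis
  have Vc: "V \<in> carrier_mat n n" using V by (simp add: unitary_by_def)
  define C2 where "C2 = quat.adj V * C * V"
  have C2: "C2 \<in> carrier_mat n n" "quat.adj C2 = C2"
    using Vc C quat.adj_congruence[OF C(1) Vc]
    by (auto simp: C2_def intro: mult_carrier_mat[of _ n n] mult_carrier_mat[of "quat.adj V" n n])
  have DC: "diag_of_list (map of_real ds) * C2 = C2 * diag_of_list (map of_real ds)"
    using quat_congruence_product[OF V V A(1) C(1)] quat_congruence_product[OF V V C(1) A(1)]
    by (simp add: comm C2_def D)
  have C2_0: "C2 $$ (i, j) = 0" if "i < n" "j < n" "ds ! i \<noteq> ds ! j" for i j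
  proof -
    have "of_real (ds ! i) * C2 $$ (i, j) = C2 $$ (i, j) * of_real (ds ! j)"
      using diag_mult_entry[OF C2(1) _ that(1,2), of "map of_real ds"]
        mult_diag_entry[OF C2(1) _ that(1,2), of "map of_real ds"] that ds by (simp add: DC)
    then show ?thesis using that(3) by (simp add: of_real_def)
  qed
  obtain y s where y: "is_eigenvector n C2 y s"
    using quat_hermitian_eigenvector[OF C2 n] by metis
  then obtain k where k: "k < n" "y k \<noteq> 0" by (auto simp: is_eigenvector_def)
  \<comment> \<open>The eigenspace is chosen through an index \<open>k\<close> with
    \<open>y k \<noteq> 0\<close>, so the truncated vector is not zero.\<close>
  define z where "z i = (if ds ! i = ds ! k then y i else 0)" for i
  have "(\<Sum>l<n. C2 $$ (i, l) * z l) = s *\<^sub>R z i" if i: "i < n" for i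
  proof (cases "ds ! i = ds ! k")
    case True
    then have "(\<Sum>l<n. C2 $$ (i, l) * z l) = (\<Sum>l<n. C2 $$ (i, l) * y l)"
      using C2_0[OF i] by (intro sum.cong) (auto simp: z_def)
    then show ?thesis using y i True by (simp add: is_eigenvector_def z_def)
  next
    case False
    then have "(\<Sum>l<n. C2 $$ (i, l) * z l) = 0"
      using C2_0[OF i] by (intro sum.neutral) (auto simp: z_def)
    then show ?thesis using False by (simp add: z_def)
  qed
  moreover have "\<exists>i<n. z i \<noteq> 0" using k by (auto simp: z_def)
  ultimately have zC: "is_eigenvector n C2 z s" by (simp add: is_eigenvector_def)
  have "(\<Sum>l<n. diag_of_list (map of_real ds) $$ (i, l) * z l) = ds ! k *\<^sub>R z i" if i: "i < n" for i
  proof -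
    have "(\<Sum>l<n. diag_of_list (map of_real ds) $$ (i, l) * z l) =
        (\<Sum>l<n. if l = i then ds ! k *\<^sub>R z l else 0)"
      using i ds by (intro sum.cong) (auto simp: z_def of_real_def)
    then show ?thesis using i by simp
  qed
  then have "is_eigenvector n (diag_of_list (map of_real ds)) z (ds ! k)"
    using \<open>\<exists>i<n. z i \<noteq> 0\<close> by (simp add: is_eigenvector_def)
  then have zA: "is_eigenvector n (quat.adj V * A * V) z (ds ! k)" by (simp only: D)
  show ?thesis
    by (rule that[OF is_eigenvector_congruence[OF V A(1) zA]
          is_eigenvector_congruence[OF V C(1) zC[unfolded C2_def]]])
qed

text \<open>The same induction, with one reflection splitting off a common eigenvector. A pair in
  \<open>ps\<close> ties together the two eigenvalues at one position; they become the standard and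
  infinitesimal parts of one dual real.\<close>

lemma quat_commuting_spectral:
  assumes "A \<in> carrier_mat n n" "quat.adj A = A" "C \<in> carrier_mat n n" "quat.adj C = C"
    and "A * C = C * A"
  shows "\<exists>V ps. unitary_by quat_cnj n V \<and> length ps = n \<and>
    quat.adj V * A * V = diag_of_list (map (\<lambda>p. of_real (fst p)) ps) \<and>
    quat.adj V * C * V = diag_of_list (map (\<lambda>p. of_real (snd p)) ps)"
  using assms
proof (induction n arbitrary: A C)
  case 0
  then show ?case
    by (intro exI[of _ "1\<^sub>m 0"] exI[of _ "[]"]) (auto simp: unitary_by_def diag_of_list_def intro!: eq_matI)
next
  case (Suc k)
  note A = Suc.prems(1,2) and C = Suc.prems(3,4)
  obtain x r s where eig: "is_eigenvector (Suc k) A x r" "is_eigenvector (Suc k) C x s"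
    using quat_common_eigenvector[OF A C Suc.prems(5)] by auto
  then have "\<exists>i<Suc k. x i \<noteq> 0" by (simp add: is_eigenvector_def)
  from eigenvector_deflation[OF this] obtain H where H: "unitary_by quat_cnj (Suc k) H"
    and defl: "\<And>A r. A \<in> carrier_mat (Suc k) (Suc k) \<Longrightarrow> quat.adj A = A \<Longrightarrow> is_eigenvector (Suc k) A x r \<Longrightarrow>
      \<exists>A'. A' \<in> carrier_mat k k \<and> quat.adj A' = A' \<and>
        quat.adj H * A * H = four_block_mat (mat 1 1 (\<lambda>_. of_real r)) (0\<^sub>m 1 k) (0\<^sub>m k 1) A'"
    by metis
  let ?F = "\<lambda>r. four_block_mat (mat 1 1 (\<lambda>_. of_real r)) (0\<^sub>m 1 k) (0\<^sub>m k 1) :: quat mat \<Rightarrow> quat mat"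
  obtain A' where A': "A' \<in> carrier_mat k k" "quat.adj A' = A'" "quat.adj H * A * H = ?F r A'"
    using defl[OF A eig(1)] by metis
  obtain C' where C': "C' \<in> carrier_mat k k" "quat.adj C' = C'" "quat.adj H * C * H = ?F s C'"
    using defl[OF C eig(2)] by metis
  have prod: "?F a X * ?F b Y = ?F (a * b) (X * Y)" if "X \<in> carrier_mat k k" "Y \<in> carrier_mat k k" for a b X Y
  proof -
    have "?F a X * ?F b Y = four_block_mat
        (mat 1 1 (\<lambda>_. of_real a) * mat 1 1 (\<lambda>_. of_real b) + 0\<^sub>m 1 k * 0\<^sub>m k 1)
        (mat 1 1 (\<lambda>_. of_real a) * 0\<^sub>m 1 k + 0\<^sub>m 1 k * Y)
        (0\<^sub>m k 1 * mat 1 1 (\<lambda>_. of_real b) + X * 0\<^sub>m k 1) (0\<^sub>m k 1 * 0\<^sub>m 1 k + X * Y)"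
      using that by (intro mult_four_block_mat) auto
    also have "\<dots> = ?F (a * b) (X * Y)"
      using that by (intro arg_cong4[of _ _ _ _ _ _ _ _ four_block_mat] eq_matI) (auto simp: scalar_prod_def)
    finally show ?thesis .
  qed
  \<comment> \<open>Congruence by \<open>H\<close> preserves commutation; comparing the lower blocks
    of both products shows that the smaller matrices commute too.\<close>
  have "?F (r * s) (A' * C') = ?F (s * r) (C' * A')"
    using quat_congruence_product[OF H H A(1) C(1)] quat_congruence_product[OF H H C(1) A(1)]
    unfolding A'(3) C'(3) Suc.prems(5) prod[OF A'(1) C'(1)] prod[OF C'(1) A'(1)] by simp
  moreover have "?F a X $$ (Suc i, Suc j) = X $$ (i, j)"
    if "X \<in> carrier_mat k k" "i < k" "j < k" for a X i j
    using that by simp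
  ultimately have "(A' * C') $$ (i, j) = (C' * A') $$ (i, j)" if "i < k" "j < k" for i j
    using that A'(1) C'(1) by (metis mult_carrier_mat)
  then have comm: "A' * C' = C' * A'"
    using A'(1) C'(1) by (intro eq_matI) (auto simp del: index_mult_mat(1))
  obtain V ps where V: "unitary_by quat_cnj k V" "length ps = k"
    "quat.adj V * A' * V = diag_of_list (map (\<lambda>p. of_real (fst p)) ps)"
    "quat.adj V * C' * V = diag_of_list (map (\<lambda>p. of_real (snd p)) ps)"
    using Suc.IH[OF A'(1,2) C'(1,2) comm] by metis
  have Vc: "V \<in> carrier_mat k k" using V(1) by (simp add: unitary_by_def)
  define B where "B = four_block_mat (1\<^sub>m 1) (0\<^sub>m 1 k) (0\<^sub>m k 1) V"
  have B: "unitary_by quat_cnj (Suc k) B"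
    unfolding B_def by (rule quat.block_diag_unitary[OF V(1)])
  have congr: "quat.adj (H * B) * X * (H * B) = quat.adj B * (quat.adj H * X * H) * B"
    if "X \<in> carrier_mat (Suc k) (Suc k)" for X
    using that H B by (intro quat.congruence_mult) (auto simp: unitary_by_def)
  have "quat.adj (H * B) * A * (H * B) = diag_of_list (map (\<lambda>p. of_real (fst p)) ((r, s) # ps))"
    "quat.adj (H * B) * C * (H * B) = diag_of_list (map (\<lambda>p. of_real (snd p)) ((r, s) # ps))"
    using congr[OF A(1)] congr[OF C(1)] quat.block_diag_congruence[OF A'(1) Vc, of "of_real r"]
      quat.block_diag_congruence[OF C'(1) Vc, of "of_real s"] V(2-4)
    by (simp_all add: A'(3) C'(3) B_def diag_of_list_Cons)
  then show ?case
    using quat.unitary_mult[OF H B] V(2)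
    by (intro exI[of _ "H * B"] exI[of _ "(r, s) # ps"]) simp
qed

section \<open>Hermitian dual quaternion matrices\<close>

interpretation dq: involution_ring dq_cnj
  by standard
    (simp_all add: dual_quat_eq_iff plus_dual_quat_def times_dual_quat_def dq_cnj_def
      quat.cj_add quat.cj_mult add.commute)

lemma dq_adjoint_eq: "dq_adjoint M = dq.adj M"
  by (simp add: dq_adjoint_def adjoint_by_def)

lemma dq_unitary_iff: "dq_unitary n U \<longleftrightarrow> unitary_by dq_cnj n U"
  by (simp add: dq_unitary_def unitary_by_def dq_adjoint_eq)

lemma st_inft_simps [simp]:
  "st 0 = 0" "inft 0 = 0" "st 1 = 1" "inft 1 = 0"
  "st (x + y) = st x + st y" "inft (x + y) = inft x + inft y"
  "st (x * y) = st x * st y" "inft (x * y) = st x * inft y + inft x * st y"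
  "st (dq_cnj x) = quat_cnj (st x)" "inft (dq_cnj x) = quat_cnj (inft x)"
  by (simp_all add: dual_quat_arith_defs dq_cnj_def)

lemma st_sum: "st (sum f S) = (\<Sum>x\<in>S. st (f x))" and inft_sum: "inft (sum f S) = (\<Sum>x\<in>S. inft (f x))"
  by (induction S rule: infinite_finite_induct) auto

definition inft_mat :: "dual_quat mat \<Rightarrow> quat mat" where
  "inft_mat M = map_mat inft M"

lemma st_inft_mat_carrier [simp]:
  "M \<in> carrier_mat n m \<Longrightarrow> st_mat M \<in> carrier_mat n m"
  "M \<in> carrier_mat n m \<Longrightarrow> inft_mat M \<in> carrier_mat n m"
  by (simp_all add: st_mat_def inft_mat_def)

lemma st_inft_mat_entry [simp]:
  "i < dim_row M \<Longrightarrow> j < dim_col M \<Longrightarrow> st_mat M $$ (i, j) = st (M $$ (i, j))"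
  "i < dim_row M \<Longrightarrow> j < dim_col M \<Longrightarrow> inft_mat M $$ (i, j) = inft (M $$ (i, j))"
  by (simp_all add: st_mat_def inft_mat_def)

lemma dq_mat_eqI:
  assumes "X \<in> carrier_mat n m" "Y \<in> carrier_mat n m" "st_mat X = st_mat Y" "inft_mat X = inft_mat Y"
  shows "X = Y"
proof (rule eq_matI)
  fix i j assume "i < dim_row Y" "j < dim_col Y"
  then show "X $$ (i, j) = Y $$ (i, j)"
    using arg_cong[OF assms(3), of "\<lambda>M. M $$ (i, j)"] arg_cong[OF assms(4), of "\<lambda>M. M $$ (i, j)"] assms(1,2)
    by (simp add: dual_quat_eq_iff)
qed (use assms in auto)

lemma st_mat_mult:
  assumes "X \<in> carrier_mat n m" "Y \<in> carrier_mat m k"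
  shows "st_mat (X * Y) = st_mat X * st_mat Y"
proof (rule eq_matI)
  have XY: "X * Y \<in> carrier_mat n k" using assms by (rule mult_carrier_mat)
  fix i j assume "i < dim_row (st_mat X * st_mat Y)" "j < dim_col (st_mat X * st_mat Y)"
  then have ij: "i < n" "j < k" using assms by (auto simp: st_mat_def)
  have "st_mat (X * Y) $$ (i, j) = st ((X * Y) $$ (i, j))"
    using XY ij by (intro st_inft_mat_entry) auto
  also have "\<dots> = (\<Sum>l<m. st (X $$ (i, l)) * st (Y $$ (l, j)))"
    by (simp only: mult_mat_entry[OF assms ij] st_sum st_inft_simps)
  also have "\<dots> = (\<Sum>l<m. st_mat X $$ (i, l) * st_mat Y $$ (l, j))"
    using assms ij by (intro sum.cong) auto
  also have "\<dots> = (st_mat X * st_mat Y) $$ (i, j)"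
    using assms ij by (intro mult_mat_entry[symmetric]) auto
  finally show "st_mat (X * Y) $$ (i, j) = (st_mat X * st_mat Y) $$ (i, j)" .
qed (use assms in \<open>auto simp: st_mat_def\<close>)

text \<open>The product rule of a derivation: the term with two infinitesimal factors carries
  \<open>\<epsilon> * \<epsilon> = 0\<close>.\<close>

lemma inft_mat_mult:
  assumes "X \<in> carrier_mat n m" "Y \<in> carrier_mat m k"
  shows "inft_mat (X * Y) = st_mat X * inft_mat Y + inft_mat X * st_mat Y"
proof (rule eq_matI)
  have XY: "X * Y \<in> carrier_mat n k" using assms by (rule mult_carrier_mat)
  fix i j assume "i < dim_row (st_mat X * inft_mat Y + inft_mat X * st_mat Y)"
    "j < dim_col (st_mat X * inft_mat Y + inft_mat X * st_mat Y)"
  then have ij: "i < n" "j < k" using assms by (auto simp: st_mat_def inft_mat_def)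
  have "inft_mat (X * Y) $$ (i, j) = inft ((X * Y) $$ (i, j))"
    using XY ij by (intro st_inft_mat_entry) auto
  also have "\<dots> = (\<Sum>l<m. st (X $$ (i, l)) * inft (Y $$ (l, j))) + (\<Sum>l<m. inft (X $$ (i, l)) * st (Y $$ (l, j)))"
    by (simp only: mult_mat_entry[OF assms ij] inft_sum st_inft_simps sum.distrib)
  also have "\<dots> = (\<Sum>l<m. st_mat X $$ (i, l) * inft_mat Y $$ (l, j)) + (\<Sum>l<m. inft_mat X $$ (i, l) * st_mat Y $$ (l, j))"
    using assms ij by (intro arg_cong2[of _ _ _ _ plus] sum.cong) auto
  also have "\<dots> = (st_mat X * inft_mat Y) $$ (i, j) + (inft_mat X * st_mat Y) $$ (i, j)"
    using assms ij
    by (intro arg_cong2[of _ _ _ _ plus] mult_mat_entry[symmetric]) auto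
  also have "\<dots> = (st_mat X * inft_mat Y + inft_mat X * st_mat Y) $$ (i, j)"
    using assms ij by (intro index_add_mat(1)[symmetric]) (auto simp: st_mat_def inft_mat_def)
  finally show "inft_mat (X * Y) $$ (i, j) = (st_mat X * inft_mat Y + inft_mat X * st_mat Y) $$ (i, j)" .
qed (use assms in \<open>auto simp: st_mat_def inft_mat_def\<close>)

lemma st_inft_mat_adj [simp]:
  "st_mat (dq.adj X) = quat.adj (st_mat X)" "inft_mat (dq.adj X) = quat.adj (inft_mat X)"
  by (auto simp: st_mat_def inft_mat_def adjoint_by_def dq_cnj_def intro!: eq_matI)

lemma st_inft_mat_one [simp]: "st_mat (1\<^sub>m n) = 1\<^sub>m n" "inft_mat (1\<^sub>m n) = 0\<^sub>m n n"
  by (auto simp: st_mat_def inft_mat_def intro!: eq_matI)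

definition dq_mat :: "quat mat \<Rightarrow> quat mat \<Rightarrow> dual_quat mat" where
  "dq_mat X Y = mat (dim_row X) (dim_col X) (\<lambda>ij. DQ (X $$ ij) (Y $$ ij))"

lemma dq_mat_carrier [simp]: "X \<in> carrier_mat n m \<Longrightarrow> dq_mat X Y \<in> carrier_mat n m"
  by (simp add: dq_mat_def)

lemma dq_mat_parts [simp]:
  assumes "X \<in> carrier_mat n m" "Y \<in> carrier_mat n m"
  shows "st_mat (dq_mat X Y) = X" "inft_mat (dq_mat X Y) = Y"
  using assms by (auto simp: dq_mat_def st_mat_def inft_mat_def intro!: eq_matI)

lemma unitary_st_mat:
  assumes "unitary_by dq_cnj n U"
  shows "unitary_by quat_cnj n (st_mat U)"
proof -
  have "U \<in> carrier_mat n n" "dq.adj U * U = 1\<^sub>m n" using assms by (auto simp: unitary_by_def)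
  then show ?thesis
    using st_mat_mult[of "dq.adj U" n n U n] by (simp add: unitary_by_def)
qed

text \<open>\<open>U * U\<^sup>*\<close> is an idempotent with standard part \<open>1\<close>, hence it is \<open>1\<close>: if \<open>1 + \<epsilon> F\<close> is idempotent,
  then \<open>2 F = F\<close>.\<close>

lemma dq_unitary_right_inverse:
  assumes "unitary_by dq_cnj n U"
  shows "U * dq.adj U = 1\<^sub>m n"
proof -
  have U: "U \<in> carrier_mat n n" "dq.adj U \<in> carrier_mat n n" "dq.adj U * U = 1\<^sub>m n"
    using assms by (auto simp: unitary_by_def)
  define E where "E = U * dq.adj U"
  have E: "E \<in> carrier_mat n n" unfolding E_def using U(1,2) by (rule mult_carrier_mat)
  have "E * E = U * (dq.adj U * U * dq.adj U)"
    using U(1,2) by (simp add: E_def mult_carrier_mat[of _ n n _ n] assoc_mult_mat[of _ n n _ n _ n])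
  then have EE: "E * E = E"
    using left_mult_one_mat[OF U(2)] by (simp only: U(3) E_def)
  have stE: "st_mat E = 1\<^sub>m n"
    using quat_unitary_right_inverse[OF unitary_st_mat[OF assms]] st_mat_mult[OF U(1,2)] by (simp add: E_def)
  have iE: "inft_mat E \<in> carrier_mat n n" using E by simp
  have "inft_mat E = inft_mat E + inft_mat E"
    using inft_mat_mult[OF E E] left_mult_one_mat[OF iE] right_mult_one_mat[OF iE] by (simp add: EE stE)
  then have "inft_mat E $$ (i, j) = inft_mat E $$ (i, j) + inft_mat E $$ (i, j)" if "i < n" "j < n" for i j
    using iE that by (metis carrier_matD index_add_mat(1))
  then have "inft_mat E $$ (i, j) = 0" if "i < n" "j < n" for i j
    using that by (simp del: st_inft_mat_entry)
  then have "inft_mat E = 0\<^sub>m n n"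
    using iE by (intro eq_matI) (auto simp del: st_inft_mat_entry)
  then show ?thesis
    unfolding E_def[symmetric] using E stE by (intro dq_mat_eqI[of _ n n]) auto
qed

section \<open>Dual reals and the diagonalization of Hermitian matrices\<close>

definition dual_real :: "real \<times> real \<Rightarrow> dual_quat" where
  "dual_real p = DQ (of_real (fst p)) (of_real (snd p))"

lemma dual_real_sel [simp]: "st (dual_real p) = of_real (fst p)" "inft (dual_real p) = of_real (snd p)"
  by (simp_all add: dual_real_def)

lemma diag_dual_real:
  "st_mat (diag_of_list (map dual_real ps)) = diag_of_list (map (\<lambda>p. of_real (fst p)) ps)"
  "inft_mat (diag_of_list (map dual_real ps)) = diag_of_list (map (\<lambda>p. of_real (snd p)) ps)"
  by (auto simp: diag_of_list_def st_mat_def inft_mat_def intro!: eq_matI)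

text \<open>Three congruences: \<open>U1\<close> diagonalizes the standard part, \<open>U2\<close>
  clears the infinitesimal part between different eigenvalues, and \<open>U3\<close> diagonalizes
  both parts, which then commute.\<close>

lemma dq_hermitian_spectral:
  assumes A: "A \<in> carrier_mat n n" and herm: "dq.adj A = A"
  obtains U ps where "unitary_by dq_cnj n U" "length ps = n"
    "dq.adj U * A * U = diag_of_list (map dual_real ps)"
proof -
  have A0: "st_mat A \<in> carrier_mat n n" "quat.adj (st_mat A) = st_mat A"
    and A1: "inft_mat A \<in> carrier_mat n n" "quat.adj (inft_mat A) = inft_mat A"
    using A st_inft_mat_adj[of A] by (simp_all add: herm)
  \<comment> \<open>A unitary without infinitesimal part acts on the two parts of \<open>M\<close>
    separately.\<close>
  have congr0: "unitary_by dq_cnj n (dq_mat X (0\<^sub>m n n))"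
    "st_mat (dq.adj (dq_mat X (0\<^sub>m n n)) * M * dq_mat X (0\<^sub>m n n)) = quat.adj X * st_mat M * X"
    "inft_mat (dq.adj (dq_mat X (0\<^sub>m n n)) * M * dq_mat X (0\<^sub>m n n)) = quat.adj X * inft_mat M * X"
    if "unitary_by quat_cnj n X" "M \<in> carrier_mat n n" for X M
  proof -
    define Y where "Y = dq_mat X (0\<^sub>m n n)"
    have X: "X \<in> carrier_mat n n" "quat.adj X * X = 1\<^sub>m n" using that(1) by (auto simp: unitary_by_def)
    then have Y: "Y \<in> carrier_mat n n" "dq.adj Y \<in> carrier_mat n n" "st_mat Y = X" "inft_mat Y = 0\<^sub>m n n"
      by (auto simp: Y_def)
    have YM: "dq.adj Y * M \<in> carrier_mat n n" using Y(2) that(2) by (rule mult_carrier_mat)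
    note c = X(1) that(2) Y mult_carrier_mat[of _ n n _ n] left_mult_zero_mat[of _ n n]
      right_mult_zero_mat[of _ n n]
    have "dq.adj Y * Y = 1\<^sub>m n"
      by (rule dq_mat_eqI[of _ n n]) (simp_all add: c X(2) st_mat_mult[of _ n n _ n] inft_mat_mult[of _ n n _ n])
    then show "unitary_by dq_cnj n (dq_mat X (0\<^sub>m n n))"
      using Y(1) by (simp add: unitary_by_def Y_def)
    show "st_mat (dq.adj (dq_mat X (0\<^sub>m n n)) * M * dq_mat X (0\<^sub>m n n)) = quat.adj X * st_mat M * X"
      by (simp add: c YM st_mat_mult[of _ n n _ n] flip: Y_def)
    show "inft_mat (dq.adj (dq_mat X (0\<^sub>m n n)) * M * dq_mat X (0\<^sub>m n n)) = quat.adj X * inft_mat M * X"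
      by (simp add: c YM st_mat_mult[of _ n n _ n] inft_mat_mult[of _ n n _ n] flip: Y_def)
  qed
  obtain V ds where V: "unitary_by quat_cnj n V" and ds: "length ds = n"
    and VA: "quat.adj V * st_mat A * V = diag_of_list (map of_real ds)"
    using quat_spectral[OF A0] by metis
  define U1 where "U1 = dq_mat V (0\<^sub>m n n)"
  define M where "M = dq.adj U1 * A * U1"
  have U1: "unitary_by dq_cnj n U1" "U1 \<in> carrier_mat n n"
    using congr0(1)[OF V A] by (auto simp: U1_def unitary_by_def)
  have M: "M \<in> carrier_mat n n" "dq.adj M = M"
    using dq.adj_congruence[OF A U1(2)] U1(2) A mult_carrier_mat[of "dq.adj U1" n n A n]
      mult_carrier_mat[of "dq.adj U1 * A" n n U1 n] by (simp_all add: M_def herm)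
  have M0: "st_mat M = diag_of_list (map of_real ds)"
    using congr0(2)[OF V A] by (simp add: M_def U1_def VA)
  define C where "C = inft_mat M"
  have C: "C \<in> carrier_mat n n" "quat.adj C = C"
    using M st_inft_mat_adj[of M] by (simp_all add: C_def)
  have Cij: "quat_cnj (C $$ (j, i)) = C $$ (i, j)" if "i < n" "j < n" for i j
    using arg_cong[OF C(2), of "\<lambda>X. X $$ (i, j)"] C(1) that by simp
  \<comment> \<open>Conjugation by \<open>1 + \<epsilon> T\<close> with \<open>T\<close> skew-Hermitian adds \<open>D T - T D\<close> to the infinitesimal part;
    \<open>x / 0 = 0\<close> makes \<open>T\<close> vanish between equal eigenvalues.\<close>
  define T where "T = mat n n (\<lambda>(i, j). (1 / (ds ! j - ds ! i)) *\<^sub>R C $$ (i, j))"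
  have T: "T \<in> carrier_mat n n" by (simp add: T_def)
  have adjT: "quat.adj T $$ (i, j) = - T $$ (i, j)" if "i < n" "j < n" for i j
  proof -
    have "1 / (ds ! i - ds ! j) = - (1 / (ds ! j - ds ! i))"
      by (metis minus_diff_eq minus_divide_right)
    then show ?thesis using that by (simp add: T_def Cij quat.cj_uminus)
  qed
  define U2 where "U2 = dq_mat (1\<^sub>m n) T"
  have U2c: "U2 \<in> carrier_mat n n" "dq.adj U2 \<in> carrier_mat n n" "st_mat U2 = 1\<^sub>m n" "inft_mat U2 = T"
    by (auto simp: U2_def dq_mat_parts[OF _ T])
  have U2: "unitary_by dq_cnj n U2"
  proof -
    \<comment> \<open>This sum is the infinitesimal part of \<open>adj U2 * U2\<close>, so unitarity
      of \<open>U2\<close> amounts to \<open>T\<close> being skew-Hermitian.\<close>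
    have "T + quat.adj T = 0\<^sub>m n n"
      using T adjT by (intro eq_matI) auto
    then have "dq.adj U2 * U2 = 1\<^sub>m n"
      using T left_mult_one_mat[of T n n] right_mult_one_mat[of "quat.adj T" n n]
      by (intro dq_mat_eqI[of _ n n])
        (simp_all add: U2c mult_carrier_mat[of _ n n _ n] st_mat_mult[of _ n n _ n] inft_mat_mult[of _ n n _ n])
    then show ?thesis using U2c by (simp add: unitary_by_def)
  qed
  define M' where "M' = dq.adj U2 * M * U2"
  have U2M: "dq.adj U2 * M \<in> carrier_mat n n" using U2c(2) M(1) by (rule mult_carrier_mat)
  have M': "M' \<in> carrier_mat n n" "dq.adj M' = M'"
    using dq.adj_congruence[OF M(1) U2c(1)] mult_carrier_mat[OF U2M U2c(1)] by (simp_all add: M'_def M(2))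
  define D :: "quat mat" where "D = diag_of_list (map of_real ds)"
  have D: "D \<in> carrier_mat n n" using diag_of_list_carrier[of "map of_real ds"] by (simp add: D_def ds)
  have M'0: "st_mat M' = D"
    using left_mult_one_mat[OF D] right_mult_one_mat[OF D]
    by (simp add: M'_def U2M M(1) U2c st_mat_mult[of _ n n _ n] M0 flip: D_def)
  have M'1: "inft_mat M' = D * T + (C + quat.adj T * D)"
  proof -
    have X: "C + quat.adj T * D \<in> carrier_mat n n"
      using C(1) T D mult_carrier_mat[of "quat.adj T" n n D n] by simp
    show ?thesis
      using left_mult_one_mat[OF D] left_mult_one_mat[OF C(1)] right_mult_one_mat[OF X]
      by (simp add: M'_def U2M M(1) U2c st_mat_mult[of _ n n _ n] inft_mat_mult[of _ n n _ n] M0 flip: D_def C_def)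
  qed
  have off: "inft_mat M' $$ (i, j) = 0" if "i < n" "j < n" "ds ! i \<noteq> ds ! j" for i j
  proof -
    have "quat.adj T * D \<in> carrier_mat n n" using T D by (intro mult_carrier_mat) auto
    then have "inft_mat M' $$ (i, j) = (D * T) $$ (i, j) + (C $$ (i, j) + (quat.adj T * D) $$ (i, j))"
      unfolding M'1 using that C(1) T D by (simp del: index_mult_mat(1))
    also have "(D * T) $$ (i, j) = ds ! i *\<^sub>R T $$ (i, j)"
      unfolding D_def using diag_mult_entry[OF T _ that(1,2), of "map of_real ds"] ds that
      by (simp add: of_real_def)
    also have "(quat.adj T * D) $$ (i, j) = - (ds ! j *\<^sub>R T $$ (i, j))"
      unfolding D_def using mult_diag_entry[of "quat.adj T" n n "map of_real ds" i j] ds that T adjT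
      by (simp add: of_real_def)
    also have "C $$ (i, j) = (ds ! j - ds ! i) *\<^sub>R T $$ (i, j)"
      using that by (simp add: T_def)
    \<comment> \<open>The coefficients of \<open>T $$ (i, j)\<close> are \<open>ds ! i\<close>,
      \<open>ds ! j - ds ! i\<close> and \<open>- (ds ! j)\<close>, which sum to zero.\<close>
    finally show ?thesis by (simp add: algebra_simps)
  qed
  have M'1c: "inft_mat M' \<in> carrier_mat n n" "quat.adj (inft_mat M') = inft_mat M'"
    using M' st_inft_mat_adj[of M'] by simp_all
  have hermD: "quat.adj D = D" using D ds by (intro eq_matI) (auto simp: D_def)
  \<comment> \<open>Commuting with the diagonal \<open>D\<close> means vanishing between different
    diagonal values, which \<open>off\<close> provides.\<close>
  have "D * inft_mat M' = inft_mat M' * D"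
  proof (rule eq_matI)
    fix i j assume "i < dim_row (inft_mat M' * D)" "j < dim_col (inft_mat M' * D)"
    then have ij: "i < n" "j < n" using M'1c D by auto
    have "of_real (ds ! i) * inft_mat M' $$ (i, j) = inft_mat M' $$ (i, j) * of_real (ds ! j)"
      using off[OF ij] by (cases "ds ! i = ds ! j") (simp_all add: of_real_def)
    then show "(D * inft_mat M') $$ (i, j) = (inft_mat M' * D) $$ (i, j)"
      unfolding D_def using diag_mult_entry[OF M'1c(1) _ ij, of "map of_real ds"]
        mult_diag_entry[OF M'1c(1) _ ij, of "map of_real ds"] ds ij by simp
  qed (use M'1c D in auto)
  from quat_commuting_spectral[OF D hermD M'1c this] obtain W ps
    where W: "unitary_by quat_cnj n W" and ps: "length ps = n"
      "quat.adj W * D * W = diag_of_list (map (\<lambda>p. of_real (fst p)) ps)"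
      "quat.adj W * inft_mat M' * W = diag_of_list (map (\<lambda>p. of_real (snd p)) ps)"
    by metis
  define U3 where "U3 = dq_mat W (0\<^sub>m n n)"
  have U3: "unitary_by dq_cnj n U3" "U3 \<in> carrier_mat n n"
    using congr0(1)[OF W A] by (auto simp: U3_def unitary_by_def)
  have U12: "U1 * U2 \<in> carrier_mat n n" using U1(2) U2c(1) by (rule mult_carrier_mat)
  have "dq.adj (U1 * U2 * U3) * A * (U1 * U2 * U3) = dq.adj U3 * (dq.adj (U1 * U2) * A * (U1 * U2)) * U3"
    using A U12 U3(2) by (rule dq.congruence_mult)
  also have "dq.adj (U1 * U2) * A * (U1 * U2) = M'"
    unfolding M'_def M_def using A U1(2) U2c(1) by (rule dq.congruence_mult)
  also have "dq.adj U3 * M' * U3 = diag_of_list (map dual_real ps)"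
  proof (rule dq_mat_eqI[of _ n n])
    show "dq.adj U3 * M' * U3 \<in> carrier_mat n n"
      using M'(1) U3(2) by (meson adjoint_by_carrier mult_carrier_mat)
    show "diag_of_list (map dual_real ps) \<in> carrier_mat n n"
      using diag_of_list_carrier[of "map dual_real ps"] by (simp add: ps(1))
    show "st_mat (dq.adj U3 * M' * U3) = st_mat (diag_of_list (map dual_real ps))"
      unfolding U3_def congr0(2)[OF W M'(1)] M'0 diag_dual_real by (rule ps(2))
    show "inft_mat (dq.adj U3 * M' * U3) = inft_mat (diag_of_list (map dual_real ps))"
      unfolding U3_def congr0(3)[OF W M'(1)] diag_dual_real by (rule ps(3))
  qed
  finally show ?thesis
    using that dq.unitary_mult[OF dq.unitary_mult[OF U1(1) U2] U3(1)] ps(1) by blast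
qed

section \<open>Ordered eigenvalue data\<close>

text \<open>Flattening keeps multiplicities, so eigenvalue data can be compared with a diagonal as
  multisets of pairs.\<close>

definition eig_pairs :: "eig_data \<Rightarrow> (real \<times> real) list" where
  "eig_pairs L = concat (map (\<lambda>(l, ms). map (Pair l) ms) L)"

lemma eig_pairs_simps [simp]:
  "eig_pairs [] = []" "eig_pairs ((l, ms) # L) = map (Pair l) ms @ eig_pairs L"
  by (simp_all add: eig_pairs_def)

text \<open>This is \<open>eig_data_ordered\<close> without \<open>L \<noteq> []\<close>, so that
  inductions can start from the empty list.\<close>

definition eig_sorted :: "eig_data \<Rightarrow> bool" where
  "eig_sorted L \<longleftrightarrow> sorted_wrt (>) (map fst L) \<and>
    (\<forall>(l, ms) \<in> set L. l > 0 \<and> ms \<noteq> [] \<and> sorted_wrt (\<ge>) ms)"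

lemma fst_eig_pairs: "\<forall>(l, ms) \<in> set L. ms \<noteq> [] \<Longrightarrow> fst ` set (eig_pairs L) = fst ` set L"
proof (induction L)
  case (Cons a L)
  obtain l ms where "a = (l, ms)" by (cases a)
  then show ?case using Cons by (simp add: image_Un image_image image_constant_conv)
qed simp

text \<open>As no group is empty, comparing \<open>l\<close> with the later group values amounts to
  comparing it with all flattened pairs, the form suited to multisets.\<close>

lemma eig_sorted_Cons:
  "eig_sorted ((l, ms) # L) \<longleftrightarrow> 0 < l \<and> ms \<noteq> [] \<and> sorted_wrt (\<ge>) ms \<and>
    (\<forall>p \<in> set (eig_pairs L). fst p < l) \<and> eig_sorted L"
proof -
  have "(\<forall>p \<in> set (eig_pairs L). fst p < l) \<longleftrightarrow> (\<forall>x \<in> fst ` set L. x < l)"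
    if "\<forall>(l, ms) \<in> set L. ms \<noteq> []"
    using fst_eig_pairs[OF that] by (metis image_eqI imageE)
  then show ?thesis
    unfolding eig_sorted_def by (simp add: case_prod_unfold) blast
qed

text \<open>The pairs with the largest first component form the leading group, with second
  components sorted; the strictly shorter rest is handled by induction.\<close>

lemma eig_sorted_exists:
  assumes "\<And>p. p \<in> set ps \<Longrightarrow> 0 < fst p"
  shows "\<exists>L. eig_sorted L \<and> mset (eig_pairs L) = mset ps"
  using assms
proof (induction "length ps" arbitrary: ps rule: less_induct)
  case less
  show ?case
  proof (cases "ps = []")
    case True
    then show ?thesis by (intro exI[of _ "[]"]) (simp add: eig_sorted_def)
  next
    case False
    define l where "l = Max (fst ` set ps)"
    define F where "F = filter (\<lambda>p. fst p = l) ps"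
    define R where "R = filter (\<lambda>p. fst p \<noteq> l) ps"
    define ms where "ms = rev (sort (map snd F))"
    have "l \<in> fst ` set ps" unfolding l_def using False by (intro Max_in) auto
    then have "F \<noteq> []" by (auto simp: F_def filter_empty_conv)
    have ps: "mset ps = mset F + mset R" by (simp add: F_def R_def multiset_partition[symmetric])
    then have "length ps = length F + length R" by (metis size_mset size_union)
    then have "length R < length ps" using \<open>F \<noteq> []\<close> by simp
    moreover have "0 < fst p" if "p \<in> set R" for p using that less.prems by (simp add: R_def)
    ultimately obtain K where K: "eig_sorted K" "mset (eig_pairs K) = mset R"
      using less.hyps by blast
    have "\<forall>p \<in> set (eig_pairs K). fst p < l"
    proof -
      have "set (eig_pairs K) = set R" using K(2) by (rule mset_eq_setD)
      moreover have "fst p \<le> l" if "p \<in> set ps" for p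
        unfolding l_def using that by (intro Max_ge) auto
      ultimately show ?thesis by (fastforce simp: R_def)
    qed
    moreover have "0 < l" using \<open>l \<in> fst ` set ps\<close> less.prems by auto
    moreover have "sorted_wrt (\<ge>) ms" by (simp add: ms_def sorted_wrt_rev)
    moreover have "ms \<noteq> []" using \<open>F \<noteq> []\<close> by (auto simp: ms_def dest: arg_cong[of _ _ length])
    ultimately have "eig_sorted ((l, ms) # K)" using K(1) by (simp add: eig_sorted_Cons)
    moreover have "mset (map (Pair l) ms) = mset F"
    proof -
      have "mset (map (Pair l) ms) = image_mset (\<lambda>p. (l, snd p)) (mset F)"
        by (simp add: ms_def multiset.map_comp comp_def)
      also have "\<dots> = image_mset id (mset F)"
        by (intro image_mset_cong) (auto simp: F_def)
      finally show ?thesis by simp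
    qed
    ultimately show ?thesis
      using K(2) ps by (intro exI[of _ "(l, ms) # K"]) simp
  qed
qed

lemma sorted_desc_unique:
  fixes xs ys :: "real list"
  assumes "mset xs = mset ys" "sorted_wrt (\<ge>) xs" "sorted_wrt (\<ge>) ys"
  shows "xs = ys"
proof -
  have "sort (rev ys) = rev xs"
    using assms by (intro properties_for_sort) (auto simp: sorted_wrt_rev)
  moreover have "sort (rev ys) = rev ys"
    using assms by (intro properties_for_sort) (auto simp: sorted_wrt_rev)
  ultimately show ?thesis by simp
qed

text \<open>The multiset determines the leading group: its value is the maximum of the first
  components, and filtering at that value returns its second components up to order, which
  sortedness then fixes.\<close>

lemma eig_sorted_unique:
  assumes "eig_sorted L" "eig_sorted L'" "mset (eig_pairs L) = mset (eig_pairs L')"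
  shows "L = L'"
  using assms
proof (induction L arbitrary: L')
  case Nil
  then show ?case by (cases L') (auto simp: eig_sorted_Cons)
next
  case (Cons a K)
  obtain l ms where a: "a = (l, ms)" by (cases a)
  obtain l' ms' K' where L': "L' = (l', ms') # K'"
    using Cons.prems by (cases L') (auto simp: a eig_sorted_Cons)
  have s: "ms \<noteq> []" "sorted_wrt (\<ge>) ms" "\<forall>p \<in> set (eig_pairs K). fst p < l" "eig_sorted K"
    and s': "ms' \<noteq> []" "sorted_wrt (\<ge>) ms'" "\<forall>p \<in> set (eig_pairs K'). fst p < l'" "eig_sorted K'"
    using Cons.prems by (auto simp: a L' eig_sorted_Cons)
  have "Max (fst ` set (eig_pairs ((l, ms) # K))) = l"
    if "ms \<noteq> []" "\<forall>p \<in> set (eig_pairs K). fst p < l" for l ms and K :: eig_data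
  proof (rule Max_eqI)
    show "l \<in> fst ` set (eig_pairs ((l, ms) # K))"
      using that(1) by (cases ms) auto
  qed (use that(2) in \<open>auto simp: less_imp_le\<close>)
  then have l: "l = l'"
    using mset_eq_setD[OF Cons.prems(3)] s s' unfolding a L' by metis
  have filt: "filter (\<lambda>p. fst p = l) (eig_pairs ((l, ms) # K)) = map (Pair l) ms"
    if "\<forall>p \<in> set (eig_pairs K). fst p < l" for l ms and K :: eig_data
    using that by (auto simp: filter_empty_conv filter_id_conv)
  have "mset (filter (\<lambda>p. fst p = l) (eig_pairs ((l, ms) # K))) =
      mset (filter (\<lambda>p. fst p = l) (eig_pairs ((l, ms') # K')))"
    using Cons.prems(3) unfolding mset_filter a L' l by (rule arg_cong)
  then have "mset (map (Pair l) ms) = mset (map (Pair l) ms')"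
    by (simp only: filt[OF s(3)] filt[OF s'(3)[folded l]])
  then have "image_mset snd (mset (map (Pair l) ms)) = image_mset snd (mset (map (Pair l) ms'))"
    by simp
  then have "mset ms = mset ms'" by (simp add: multiset.map_comp comp_def)
  then have ms: "ms = ms'" using s s' by (intro sorted_desc_unique)
  then have "mset (eig_pairs K) = mset (eig_pairs K')"
    using Cons.prems(3) by (simp add: a L' l)
  then show ?case using Cons.IH[OF s(4) s'(4)] by (simp add: a L' l ms)
qed

section \<open>Existence and uniqueness of the diagonal form\<close>

text \<open>The change of basis \<open>W = adj U * U'\<close> is unitary and satisfies
  \<open>D W = W D'\<close>; its standard part \<open>P\<close> suffices for counting the diagonal
  entries.\<close>

lemma dq_diagonal_unique:
  assumes A: "A \<in> carrier_mat n n"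
    and U: "unitary_by dq_cnj n U" "length ps = n" "dq.adj U * A * U = diag_of_list (map dual_real ps)"
    and U': "unitary_by dq_cnj n U'" "length ps' = n" "dq.adj U' * A * U' = diag_of_list (map dual_real ps')"
  shows "mset ps = mset ps'"
proof -
  define D where "D = diag_of_list (map dual_real ps)"
  define D' where "D' = diag_of_list (map dual_real ps')"
  have c: "U \<in> carrier_mat n n" "dq.adj U \<in> carrier_mat n n" "U' \<in> carrier_mat n n" "dq.adj U' \<in> carrier_mat n n"
    using U(1) U'(1) by (auto simp: unitary_by_def)
  define W where "W = dq.adj U * U'"
  have W: "W \<in> carrier_mat n n" unfolding W_def using c(2,3) by (rule mult_carrier_mat)
  note assoc = assoc_mult_mat[of _ n n _ n _ n] mult_carrier_mat[of _ n n _ n]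
  have "D * W = dq.adj U * (A * U')"
    unfolding D_def W_def U(3)[symmetric]
    by (simp add: A c assoc dq.mult_adj_cancel[OF c(1) dq_unitary_right_inverse[OF U(1)]])
  also have "\<dots> = W * D'"
    unfolding D'_def W_def U'(3)[symmetric]
    by (simp add: A c assoc dq.mult_adj_cancel[OF c(3) dq_unitary_right_inverse[OF U'(1)]])
  finally have DW: "D * W = W * D'" .
  define P where "P = st_mat W"
  have P: "P \<in> carrier_mat n n" using W by (simp add: P_def)
  have "unitary_by dq_cnj n (dq.adj U)"
    using dq_unitary_right_inverse[OF U(1)] c by (simp add: unitary_by_def)
  then have uP: "unitary_by quat_cnj n P"
    unfolding P_def W_def by (intro unitary_st_mat dq.unitary_mult U'(1))
  have match: "ps ! i = ps' ! j" if ij: "i < n" "j < n" and "P $$ (i, j) \<noteq> 0" for i j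
  proof -
    have nz: "st (W $$ (i, j)) \<noteq> 0" using that W by (simp add: P_def)
    have eq: "dual_real (ps ! i) * W $$ (i, j) = W $$ (i, j) * dual_real (ps' ! j)"
      using diag_mult_entry[OF W _ ij, of "map dual_real ps"] mult_diag_entry[OF W _ ij, of "map dual_real ps'"]
        ij U(2) U'(2) DW by (simp add: D_def D'_def)
    have "fst (ps ! i) *\<^sub>R st (W $$ (i, j)) = fst (ps' ! j) *\<^sub>R st (W $$ (i, j))"
      using arg_cong[OF eq, of st] by (simp add: of_real_def)
    then have 1: "fst (ps ! i) = fst (ps' ! j)" using nz by simp
    \<comment> \<open>Once the first components agree, their products with the infinitesimal part of
      \<open>W $$ (i, j)\<close> are equal on both sides and cancel.\<close>
    have "snd (ps ! i) *\<^sub>R st (W $$ (i, j)) = snd (ps' ! j) *\<^sub>R st (W $$ (i, j))"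
      using arg_cong[OF eq, of inft] by (simp add: of_real_def 1 add.commute)
    then have "snd (ps ! i) = snd (ps' ! j)" using nz by simp
    with 1 show ?thesis by (rule prod_eqI)
  qed
  \<comment> \<open>The squared moduli of the entries of \<open>P\<close> form a doubly stochastic matrix supported on the
    pairs \<open>(i, j)\<close> with \<open>ps ! i = ps' ! j\<close>.\<close>
  have cols: "(\<Sum>i<n. quat_nsq (P $$ (i, j))) = 1" if j: "j < n" for j
  proof -
    have "(quat.adj P * P) $$ (j, j) = (\<Sum>i<n. quat.adj P $$ (j, i) * P $$ (i, j))"
      using P j by (intro mult_mat_entry[of _ n n _ n]) auto
    also have "\<dots> = of_real (\<Sum>i<n. quat_nsq (P $$ (i, j)))"
      using P j by (simp add: quat_cnj_mult_self)
    finally have "qre (1\<^sub>m n $$ (j, j)) = (\<Sum>i<n. quat_nsq (P $$ (i, j)))"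
      using uP by (simp add: unitary_by_def del: of_real_sum)
    then show ?thesis using j by simp
  qed
  have rows: "(\<Sum>j<n. quat_nsq (P $$ (i, j))) = 1" if i: "i < n" for i
  proof -
    have "(P * quat.adj P) $$ (i, i) = (\<Sum>j<n. P $$ (i, j) * quat.adj P $$ (j, i))"
      using P i by (intro mult_mat_entry[of _ n n _ n]) auto
    also have "\<dots> = of_real (\<Sum>j<n. quat_nsq (P $$ (i, j)))"
      using P i by (simp add: quat_cnj_mult_self)
    finally have "qre (1\<^sub>m n $$ (i, i)) = (\<Sum>j<n. quat_nsq (P $$ (i, j)))"
      using quat_unitary_right_inverse[OF uP] by (simp del: of_real_sum)
    then show ?thesis using i by simp
  qed
  have "count (mset ps) p = count (mset ps') p" for p
  proof -
    define S where "S = {i. i < n \<and> ps ! i = p}"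
    define S' where "S' = {j. j < n \<and> ps' ! j = p}"
    have sub: "S \<subseteq> {..<n}" "S' \<subseteq> {..<n}" by (auto simp: S_def S'_def)
    \<comment> \<open>Double counting: the rows in \<open>S\<close> have all their weight in the
      columns \<open>S'\<close> and conversely, so the weight of this block equals both
      cardinalities.\<close>
    have "real (card S) = (\<Sum>i\<in>S. \<Sum>j<n. quat_nsq (P $$ (i, j)))"
      using rows by (simp add: S_def)
    also have "\<dots> = (\<Sum>i\<in>S. \<Sum>j\<in>S'. quat_nsq (P $$ (i, j)))"
      using sub match
      by (intro sum.cong refl sum.mono_neutral_right) (auto simp: S_def S'_def)
    also have "\<dots> = (\<Sum>j\<in>S'. \<Sum>i\<in>S. quat_nsq (P $$ (i, j)))"
      by (rule sum.swap)
    also have "\<dots> = (\<Sum>j\<in>S'. \<Sum>i<n. quat_nsq (P $$ (i, j)))"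
      using sub match
      by (intro sum.cong refl sum.mono_neutral_left) (auto simp: S_def S'_def)
    also have "\<dots> = real (card S')"
      using cols by (simp add: S'_def)
    finally have "card S = card S'" by simp
    then show ?thesis
      using U(2) U'(2) by (simp add: count_mset count_list_eq_length_filter length_filter_conv_card
          S_def S'_def eq_commute[of p])
  qed
  then show ?thesis by (rule multiset_eqI)
qed

section \<open>From diagonals of dual reals to grouped eigenvalue data\<close>

lemma eig_diagonal_eq: "eig_diagonal L = map dual_real (eig_pairs L)"
proof -
  have "of_real l + of_real m * \<epsilon> = dual_real (l, m)" for l m
    by (simp add: dual_quat_eq_iff eps_def of_real_def scaleR_dual_quat_def)
  then show ?thesis
    by (auto simp: eig_diagonal_def eig_pairs_def map_concat comp_def case_prod_unfold)
qed

text \<open>The zero block turns into trailing pairs \<open>(0, 0)\<close>, so that the whole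
  diagonal form is one list of dual reals.\<close>

lemma diagonalizes_iff:
  "diagonalizes n A U L \<longleftrightarrow> unitary_by dq_cnj n U \<and> L \<noteq> [] \<and> eig_sorted L \<and>
    (\<exists>r. dq.adj U * A * U = diag_of_list (map dual_real (eig_pairs L @ replicate r (0, 0))))"
proof -
  have "dual_real (0, 0) = 0" by (simp add: dual_quat_eq_iff)
  then have "diag_of_list (map dual_real (eig_pairs L @ replicate r (0, 0))) =
      diag_block_mat [diag_of_list (eig_diagonal L), 0\<^sub>m r r]" for r
    by (simp add: eig_diagonal_eq diag_of_list_append_zeros del: diag_block_mat.simps)
  then show ?thesis
    by (simp only: diagonalizes_def dq_unitary_iff dq_adjoint_eq eig_data_ordered_def eig_sorted_def conj_assoc)
qed

text \<open>Listed pairs have positive first components, so filtering on positivity strips the zero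
  padding without first comparing \<open>r\<close> with \<open>r'\<close>.\<close>

lemma diagonalizes_unique:
  assumes A: "A \<in> carrier_mat n n" and L: "diagonalizes n A U L" and L': "diagonalizes n A U' L'"
  shows "L = L'"
proof -
  obtain r where U: "unitary_by dq_cnj n U" and s: "eig_sorted L"
    and D: "dq.adj U * A * U = diag_of_list (map dual_real (eig_pairs L @ replicate r (0, 0)))"
    using L by (auto simp: diagonalizes_iff)
  obtain r' where U': "unitary_by dq_cnj n U'" and s': "eig_sorted L'"
    and D': "dq.adj U' * A * U' = diag_of_list (map dual_real (eig_pairs L' @ replicate r' (0, 0)))"
    using L' by (auto simp: diagonalizes_iff)
  have len: "length ps = n" if "unitary_by dq_cnj n V" "dq.adj V * A * V = diag_of_list (map dual_real ps)" for V ps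
    using arg_cong[OF that(2), of dim_row] unitary_by_carrier[OF that(1)] by (simp add: diag_of_list_def)
  have "mset (eig_pairs L @ replicate r (0, 0)) = mset (eig_pairs L' @ replicate r' (0, 0))"
    using A U len[OF U D] D U' len[OF U' D'] D' by (rule dq_diagonal_unique)
  then have filtered: "mset (filter (\<lambda>p. 0 < fst p) (eig_pairs L @ replicate r (0, 0))) =
      mset (filter (\<lambda>p. 0 < fst p) (eig_pairs L' @ replicate r' (0, 0)))"
    by (simp only: mset_filter)
  have filter_pos: "filter (\<lambda>p. 0 < fst p) (eig_pairs K @ replicate k (0, 0)) = eig_pairs K"
    if "eig_sorted K" for K k
  proof -
    have "\<forall>p \<in> set (eig_pairs K). 0 < fst p"
      using that by (auto simp: eig_sorted_def eig_pairs_def)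
    then show ?thesis by (simp add: filter_id_conv)
  qed
  show ?thesis
    using s s' filtered[unfolded filter_pos[OF s] filter_pos[OF s']] by (rule eig_sorted_unique)
qed

text \<open>The diagonal entries are those of \<open>adj C * C\<close> with \<open>C = B U\<close>.
  Their standard parts are squared lengths of standard columns, hence nonnegative, which separates
  the positive pairs from the zero block.\<close>

lemma diagonalizes_exists:
  assumes B: "B \<in> carrier_mat m n" and nz: "st_mat B \<noteq> 0\<^sub>m m n"
  shows "\<exists>U L. diagonalizes n (dq.adj B * B) U L"
proof -
  define A where "A = dq.adj B * B"
  have B': "dq.adj B \<in> carrier_mat n m" using B by simp
  have A: "A \<in> carrier_mat n n" unfolding A_def using B' B by (rule mult_carrier_mat)
  have "dq.adj A = A" using dq.adj_mult[OF B' B] by (simp add: A_def)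
  with A obtain U ps where U: "unitary_by dq_cnj n U" and len: "length ps = n"
    and D: "dq.adj U * A * U = diag_of_list (map dual_real ps)"
    by (rule dq_hermitian_spectral)
  have Uc: "U \<in> carrier_mat n n" "dq.adj U \<in> carrier_mat n n" using U by (auto simp: unitary_by_def)
  define C where "C = B * U"
  have C: "C \<in> carrier_mat m n" unfolding C_def using B Uc(1) by (rule mult_carrier_mat)
  have "dq.adj C * C = dq.adj U * (dq.adj B * (B * U))"
    unfolding C_def dq.adj_mult[OF B Uc(1)]
    by (rule assoc_mult_mat[of _ n n _ m _ n]) (use Uc B' C in \<open>auto simp: C_def\<close>)
  also have "dq.adj B * (B * U) = A * U"
    unfolding A_def using B' B Uc(1) by (rule assoc_mult_mat[symmetric])
  also have "dq.adj U * (A * U) = dq.adj U * A * U"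
    using Uc(2) A Uc(1) by (rule assoc_mult_mat[symmetric])
  finally have CC: "dq.adj C * C = diag_of_list (map dual_real ps)" by (simp only: D)
  have entry: "dual_real (ps ! i) = (\<Sum>k<m. dq_cnj (C $$ (k, i)) * C $$ (k, i))" if i: "i < n" for i
  proof -
    have "dual_real (ps ! i) = (dq.adj C * C) $$ (i, i)" using i by (simp add: CC len)
    also have "\<dots> = (\<Sum>k<m. dq.adj C $$ (i, k) * C $$ (k, i))"
      using C i by (intro mult_mat_entry[of _ n m _ n]) auto
    finally show ?thesis using C i by simp
  qed
  have fst_eq: "fst (ps ! i) = (\<Sum>k<m. quat_nsq (st (C $$ (k, i))))" if "i < n" for i
    using arg_cong[OF entry[OF that], of "\<lambda>x. qre (st x)"]
    by (simp add: st_sum quat_cnj_mult_self qre_sum)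
  have st0: "st (C $$ (k, i)) = 0" if "i < n" "k < m" "fst (ps ! i) = 0" for i k
  proof -
    have "(\<Sum>k<m. quat_nsq (st (C $$ (k, i)))) = 0" using fst_eq[OF that(1)] that(3) by simp
    then show ?thesis using that(2) by (simp add: sum_nonneg_eq_0_iff)
  qed
  have zero: "ps ! i = (0, 0)" if "i < n" "\<not> 0 < fst (ps ! i)" for i
  proof -
    have 0: "fst (ps ! i) = 0"
      using that(2) fst_eq[OF that(1)] sum_nonneg[of "{..<m}" "\<lambda>k. quat_nsq (st (C $$ (k, i)))"] by simp
    \<comment> \<open>By the product rule every term of the infinitesimal part contains a standard
      part from column \<open>i\<close> of \<open>C\<close> or its conjugate, and these
      vanish.\<close>
    have "inft (dual_real (ps ! i)) = 0"
      unfolding entry[OF that(1)] inft_sum using st0[OF that(1) _ 0] by (intro sum.neutral) simp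
    then have "snd (ps ! i) = 0" by (simp add: of_real_def)
    with 0 show ?thesis by (simp add: prod_eq_iff)
  qed
  \<comment> \<open>Otherwise \<open>st_mat C\<close> would vanish, and cancelling the unitary
    \<open>st_mat U\<close> would give \<open>st_mat B = 0\<close>. This makes the eigenvalue data
    nonempty.\<close>
  have "\<exists>p \<in> set ps. 0 < fst p"
  proof (rule ccontr)
    assume "\<not> ?thesis"
    then have "ps ! i = (0, 0)" if "i < n" for i using zero[OF that] len that by (meson nth_mem)
    then have "st_mat C = 0\<^sub>m m n"
      using C st0 by (intro eq_matI) (auto simp: st_mat_def)
    then have BU: "st_mat B * st_mat U = 0\<^sub>m m n"
      using st_mat_mult[OF B Uc(1)] by (simp add: C_def)
    have c: "st_mat B \<in> carrier_mat m n" "st_mat U \<in> carrier_mat n n" "quat.adj (st_mat U) \<in> carrier_mat n n"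
      using B Uc by auto
    have "st_mat B = st_mat B * (st_mat U * quat.adj (st_mat U))"
      using right_mult_one_mat[OF c(1)] quat_unitary_right_inverse[OF unitary_st_mat[OF U]] by simp
    also have "\<dots> = st_mat B * st_mat U * quat.adj (st_mat U)"
      using c by (rule assoc_mult_mat[symmetric])
    also have "\<dots> = 0\<^sub>m m n" unfolding BU using c(3) by (rule left_mult_zero_mat)
    finally show False using nz by simp
  qed
  moreover define pos where "pos = filter (\<lambda>p. 0 < fst p) ps"
  ultimately have "pos \<noteq> []" by (auto simp: filter_empty_conv)
  obtain L where L: "eig_sorted L" "mset (eig_pairs L) = mset pos"
    using eig_sorted_exists[of pos] by (auto simp: pos_def)
  define r where "r = length (filter (\<lambda>p. \<not> 0 < fst p) ps)"
  have "p = (0, 0)" if "p \<in> set ps" "\<not> 0 < fst p" for p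
    using zero len that by (metis in_set_conv_nth)
  then have "filter (\<lambda>p. \<not> 0 < fst p) ps = replicate r (0, 0)"
    unfolding r_def by (intro replicate_length_same[symmetric]) auto
  \<comment> \<open>The positive pairs, grouped in \<open>L\<close>, and the pairs
    \<open>(0, 0)\<close> exhaust the diagonal, so only a permutation remains.\<close>
  then have "mset ps = mset (eig_pairs L @ replicate r (0, 0))"
    using L(2) multiset_partition[of "mset ps" "\<lambda>p. 0 < fst p"]
    by (simp add: pos_def mset_filter[symmetric] del: mset_filter)
  then have "mset (map dual_real ps) = mset (map dual_real (eig_pairs L @ replicate r (0, 0)))"
    by (simp only: mset_map)
  then obtain P where P: "unitary_by dq_cnj n P"
    "dq.adj P * diag_of_list (map dual_real ps) * P =
      diag_of_list (map dual_real (eig_pairs L @ replicate r (0, 0)))"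
    using dq.diag_reorder len by (metis length_map)
  have "dq.adj (U * P) * A * (U * P) = diag_of_list (map dual_real (eig_pairs L @ replicate r (0, 0)))"
    using dq.congruence_mult[OF A Uc(1) unitary_by_carrier[OF P(1)]] P(2) by (simp only: D)
  moreover have "L \<noteq> []" using L(2) \<open>pos \<noteq> []\<close> by auto
  ultimately have "diagonalizes n A (U * P) L"
    using dq.unitary_mult[OF U P(1)] L(1) by (auto simp only: diagonalizes_iff)
  then show ?thesis unfolding A_def by blast
qed

theorem theorem5p1:
  fixes A B :: "dual_quat mat" and m n :: nat
  assumes "B \<in> carrier_mat m n"
    and "st_mat B \<noteq> 0\<^sub>m m n"
    and "A = dq_adjoint B * B"
  shows "(\<exists>U L. diagonalizes n A U L) \<and>
    (\<forall>U L U' L'. diagonalizes n A U L \<longrightarrow> diagonalizes n A U' L' \<longrightarrow> L = L')"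
proof -
  have A: "A = dq.adj B * B" using assms(3) by (simp add: dq_adjoint_eq)
  have "A \<in> carrier_mat n n"
    unfolding A by (rule mult_carrier_mat) (use assms(1) in auto)
  then show ?thesis
    using diagonalizes_exists[OF assms(1,2)] diagonalizes_unique by (metis A)
qed

end
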